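(* For every nontrivial knot type $[K]$, $\mathrm{sps}[K]\le \mathrm{pl}[K]$.
   Context: A planar stick diagram of $[K]$ is a closed polygonal curve in the plane (finitely many straight line segments, called edges, joined end to end), whose self-intersections are transverse double points in the interiors of edges, with over/under crossing information at each self-intersection, representing $[K]$; $\mathrm{pl}[K]$ is the smallest number of edges in such a diagram. A spherical stick diagram of $[K]$ is a closed curve on the 2-sphere formed by finitely many arcs of great circles (not entire great circles) joined end to end, whose self-intersections are transverse double points away from the arc endpoints, with crossing information at each self-intersection, representing $[K]$. For nontrivial $[K]$, $\mathrm{sps}[K]$ is the minimum number of great circle arcs in such a diagram (undefined for the unknot). *)

theory Defs
  imports "HOL-Analysis.Analysis"
begin

type_synonym pt2 = "real \<times> real"
type_synonym pt3 = "real \<times> real \<times> real"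

definition is_knot :: "pt3 set \<Rightarrow> bool" where
  "is_knot K \<longleftrightarrow> (\<exists>g. simple_path g \<and> pathfinish g = pathstart g \<and> path_image g = K)"

definition ambient_isotopic :: "pt3 set \<Rightarrow> pt3 set \<Rightarrow> bool" where
  "ambient_isotopic A B \<longleftrightarrow>
     (\<exists>H :: real \<times> pt3 \<Rightarrow> pt3.
        continuous_on ({0..1} \<times> UNIV) H \<and>
        (\<forall>t\<in>{0..1}. \<exists>g. homeomorphism UNIV UNIV (\<lambda>x. H (t, x)) g) \<and>
        (\<forall>x. H (0, x) = x) \<and>
        (\<lambda>x. H (1, x)) ` A = B)"

fun join_list :: "(real \<Rightarrow> 'a::topological_space) list \<Rightarrow> real \<Rightarrow> 'a" where
  "join_list [] = (\<lambda>t. undefined)"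
| "join_list [e] = e"
| "join_list (e # es) = e +++ join_list es"

definition poly_edges :: "('a::real_normed_vector) list \<Rightarrow> (real \<Rightarrow> 'a) list" where
  "poly_edges vs = map (\<lambda>i. linepath (vs ! i) (vs ! ((i + 1) mod length vs))) [0..<length vs]"

definition polygonal_knot :: "pt3 list \<Rightarrow> bool" where
  "polygonal_knot vs \<longleftrightarrow> vs \<noteq> [] \<and> simple_path (join_list (poly_edges vs)) \<and>
     pathfinish (join_list (poly_edges vs)) = pathstart (join_list (poly_edges vs))"

definition tame :: "pt3 set \<Rightarrow> bool" where
  "tame K \<longleftrightarrow> (\<exists>vs. polygonal_knot vs \<and> ambient_isotopic (path_image (join_list (poly_edges vs))) K)"

definition round_circle :: "pt3 set" where
  "round_circle = {(x, y, 0) | x y. x\<^sup>2 + y\<^sup>2 = 1}"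

definition is_unknot :: "pt3 set \<Rightarrow> bool" where
  "is_unknot K \<longleftrightarrow> ambient_isotopic round_circle K"

text \<open>A closed curve made of the edges es (each edge a path on [0,1]), whose
  self-intersections are double points away from the edge endpoints, and which
  are transverse; transversality of edges i and j is the predicate tr i j.\<close>
definition regular_edge_curve ::
  "(real \<Rightarrow> 'a::topological_space) list \<Rightarrow> (nat \<Rightarrow> nat \<Rightarrow> bool) \<Rightarrow> bool" where
  "regular_edge_curve es tr \<longleftrightarrow>
     (let n = length es; V = {(es ! i) 0 | i. i < n} in
      n \<ge> 1 \<and>
      (\<forall>i<n. continuous_on {0..1} (es ! i)) \<and>
      (\<forall>i<n. (es ! i) 1 = (es ! ((i + 1) mod n)) 0) \<and>
      (\<forall>i<n. inj_on (es ! i) {0..1}) \<and>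
      (\<forall>i<n. \<forall>j<n. \<forall>s\<in>{0..1}. (es ! j) s = (es ! i) 0 \<longrightarrow>
          (j = i \<and> s = 0) \<or> (j = (i + n - 1) mod n \<and> s = 1)) \<and>
      (\<forall>x. card {i. i < n \<and> x \<in> (es ! i) ` {0..1}} \<le> 2) \<and>
      (\<forall>i<n. \<forall>j<n. i \<noteq> j \<longrightarrow>
          (\<forall>x \<in> (es ! i) ` {0..1} \<inter> (es ! j) ` {0..1}. x \<notin> V \<longrightarrow> tr i j)))"

definition cross2 :: "pt2 \<Rightarrow> pt2 \<Rightarrow> real" where
  "cross2 u v = fst u * snd v - snd u * fst v"

definition proj_xy :: "pt3 \<Rightarrow> pt2" where
  "proj_xy p = (fst p, fst (snd p))"

definition planar_stick_curve :: "pt2 list \<Rightarrow> bool" where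
  "planar_stick_curve ws \<longleftrightarrow>
     regular_edge_curve (poly_edges ws)
       (\<lambda>i j. cross2 (ws ! ((i + 1) mod length ws) - ws ! i)
                     (ws ! ((j + 1) mod length ws) - ws ! j) \<noteq> 0)"

text \<open>The diagram, equipped with crossing information, represents the knot type
  of K: crossing information is encoded by a lift of the plane curve to a knot in
  R^3 (adding a height coordinate); at each double point the strand with larger
  height is the over-strand. Quantifying over all lifts = quantifying over all
  choices of crossing information.\<close>
definition planar_represents :: "pt2 list \<Rightarrow> pt3 set \<Rightarrow> bool" where
  "planar_represents ws K \<longleftrightarrow>
     (\<exists>q. simple_path q \<and> pathfinish q = pathstart q \<and>
          (\<forall>t\<in>{0..1}. proj_xy (q t) = join_list (poly_edges ws) t) \<and>
          ambient_isotopic (path_image q) K)"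

definition pl :: "pt3 set \<Rightarrow> nat" where
  "pl K = (LEAST n. \<exists>ws. length ws = n \<and> planar_stick_curve ws \<and> planar_represents ws K)"

definition cross3 :: "pt3 \<Rightarrow> pt3 \<Rightarrow> pt3" where
  "cross3 u v = (case u of (u1, u2, u3) \<Rightarrow> case v of (v1, v2, v3) \<Rightarrow>
      (u2 * v3 - u3 * v2, u3 * v1 - u1 * v3, u1 * v2 - u2 * v1))"

text \<open>Great circle arc starting at a (unit), initial unit direction u orthogonal
  to a, of angle th.\<close>
definition gc_arc :: "pt3 \<Rightarrow> pt3 \<Rightarrow> real \<Rightarrow> real \<Rightarrow> pt3" where
  "gc_arc a u th t = cos (th * t) *\<^sub>R a + sin (th * t) *\<^sub>R u"

definition arc_path :: "pt3 \<times> pt3 \<times> real \<Rightarrow> real \<Rightarrow> pt3" where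
  "arc_path A = (case A of (a, u, th) \<Rightarrow> gc_arc a u th)"

definition valid_arc :: "pt3 \<times> pt3 \<times> real \<Rightarrow> bool" where
  "valid_arc A = (case A of (a, u, th) \<Rightarrow>
      norm a = 1 \<and> norm u = 1 \<and> inner a u = 0 \<and> 0 < th \<and> th < 2 * pi)"

definition arc_normal :: "pt3 \<times> pt3 \<times> real \<Rightarrow> pt3" where
  "arc_normal A = (case A of (a, u, th) \<Rightarrow> cross3 a u)"

definition spherical_stick_curve :: "(pt3 \<times> pt3 \<times> real) list \<Rightarrow> bool" where
  "spherical_stick_curve as \<longleftrightarrow>
     (\<forall>A\<in>set as. valid_arc A) \<and>
     regular_edge_curve (map arc_path as)
       (\<lambda>i j. cross3 (arc_normal (as ! i)) (arc_normal (as ! j)) \<noteq> 0)"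

text \<open>Crossing information encoded by a radial lift t \<mapsto> r(t) c(t), r > 0;
  at a double point the strand farther from the centre is the over-strand.\<close>
definition spherical_represents :: "(pt3 \<times> pt3 \<times> real) list \<Rightarrow> pt3 set \<Rightarrow> bool" where
  "spherical_represents as K \<longleftrightarrow>
     (\<exists>r :: real \<Rightarrow> real. continuous_on {0..1} r \<and> (\<forall>t\<in>{0..1}. r t > 0) \<and> r 0 = r 1 \<and>
        simple_path (\<lambda>t. r t *\<^sub>R join_list (map arc_path as) t) \<and>
        ambient_isotopic (path_image (\<lambda>t. r t *\<^sub>R join_list (map arc_path as) t)) K)"

definition sps :: "pt3 set \<Rightarrow> nat" where
  "sps K = (LEAST n. \<exists>as. length as = n \<and> spherical_stick_curve as \<and> spherical_represents as K)"

end

theory Submission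
  imports Defs
begin

text \<open>
  Central projection of the plane \<open>z = 1\<close> to the unit sphere maps a segment onto a great circle arc,
  so a planar stick diagram becomes a spherical one with the same number of edges. If the planar
  diagram lifts to the knot with points \<open>(x, y, h)\<close>, the spherical one lifts radially to the points
  \<open>h (x, y, 1)\<close>; for \<open>h \<ge> 1\<close> the two are isotopic by scaling the horizontal planes. Since \<open>pl\<close> is a
  \<open>LEAST\<close>, a planar diagram must also be shown to exist: project a polygonal representative along
  \<open>(a, b, 1)\<close>, where \<open>(a, b)\<close> avoids finitely many null sets (lines, points, and the curves formed by
  the directions of the common transversals of three edges).
\<close>

section \<open>Ambient isotopy\<close>

text \<open>Central projection matches images, not parametrizations: an arc runs at constant angular
  speed, a segment at constant speed. The joined curves therefore correspond only up to an injective
  change of parameter \<open>f\<close>, and since a planar lift \<open>q\<close> is tied to the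
  planar parameter, the spherical lift is built from \<open>q\<close> after \<open>f\<close>. This
  is why paths are compared through a relation between their values and not by equality. The bound
  on the heights is free: the knot is compact, so adding a large constant to all heights makes them
  at least 1. The direction \<open>(a, b, 1)\<close> ranges over a plane, so each way in which a
  projection can degenerate has to cost at least one dimension. For triple points this holds because
  a line through a given point of one edge that meets two other lines in general position has its
  direction determined, which leaves the position on the first edge as the only parameter.\<close>

text \<open>Run the isotopy backwards after undoing its final map. This needs the inverse at time 1
  only; inverting at every time would require joint continuity of the inverses.\<close>

lemma ambient_isotopic_sym:
  assumes "ambient_isotopic A B"
  shows "ambient_isotopic B A"
proof -
  obtain H :: "real \<times> pt3 \<Rightarrow> pt3" where H: "continuous_on ({0..1} \<times> UNIV) H"
    "\<forall>t\<in>{0..1}. \<exists>g. homeomorphism UNIV UNIV (\<lambda>x. H (t, x)) g"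
    "\<forall>x. H (0, x) = x" "(\<lambda>x. H (1, x)) ` A = B"
    using assms unfolding ambient_isotopic_def by blast
  obtain g where g: "homeomorphism UNIV UNIV (\<lambda>x. H (1, x)) g"
    using bspec[OF H(2), of 1] by auto
  have gc: "continuous_on UNIV g" and gH: "g (H (1, x)) = x" and Hg: "H (1, g x) = x" for x
    using g by (simp_all add: homeomorphism_def del: split_paired_All)
  have "homeomorphism UNIV UNIV g (\<lambda>x. H (1, x))"
    using g homeomorphism_symD by blast
  then have "\<exists>k. homeomorphism UNIV UNIV (\<lambda>x. H (1 - t, g x)) k" if "t \<in> {0..1}" for t
    using bspec[OF H(2), of "1 - t"] that homeomorphism_compose[of UNIV UNIV g _ UNIV "\<lambda>x. H (1 - t, x)"]
    by (fastforce simp: o_def)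
  moreover have "continuous_on ({0..1} \<times> UNIV) (\<lambda>z. H (1 - fst z, g (snd z)))"
    by (rule continuous_on_compose2[OF H(1)])
       (auto intro!: continuous_intros continuous_on_compose2[OF gc])
  moreover have "(\<lambda>x. H (0, g x)) ` B = A"
    unfolding H(4)[symmetric] image_image gH H(3)[rule_format] by simp
  ultimately show ?thesis
    unfolding ambient_isotopic_def
    by (intro exI[of _ "\<lambda>z. H (1 - fst z, g (snd z))"]) (use Hg in auto)
qed

text \<open>Both isotopies run simultaneously, which avoids pasting them along the time
  axis.\<close>

lemma ambient_isotopic_trans:
  assumes "ambient_isotopic A B" "ambient_isotopic B C"
  shows "ambient_isotopic A C"
proof -
  obtain H :: "real \<times> pt3 \<Rightarrow> pt3" where H: "continuous_on ({0..1} \<times> UNIV) H"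
    "\<forall>t\<in>{0..1}. \<exists>g. homeomorphism UNIV UNIV (\<lambda>x. H (t, x)) g"
    "\<forall>x. H (0, x) = x" "(\<lambda>x. H (1, x)) ` A = B"
    using assms(1) unfolding ambient_isotopic_def by blast
  obtain G :: "real \<times> pt3 \<Rightarrow> pt3" where G: "continuous_on ({0..1} \<times> UNIV) G"
    "\<forall>t\<in>{0..1}. \<exists>g. homeomorphism UNIV UNIV (\<lambda>x. G (t, x)) g"
    "\<forall>x. G (0, x) = x" "(\<lambda>x. G (1, x)) ` B = C"
    using assms(2) unfolding ambient_isotopic_def by blast
  have "\<exists>k. homeomorphism UNIV UNIV (\<lambda>x. G (t, H (t, x))) k" if "t \<in> {0..1}" for t
    using bspec[OF H(2) that] bspec[OF G(2) that] homeomorphism_compose[of UNIV UNIV "\<lambda>x. H (t, x)" _ UNIV "\<lambda>x. G (t, x)"]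
    by (fastforce simp: o_def)
  moreover have "continuous_on ({0..1} \<times> UNIV) (\<lambda>z. G (fst z, H z))"
    by (rule continuous_on_compose2[OF G(1)]) (auto intro!: continuous_intros H(1))
  moreover have "(\<lambda>x. G (1, H (1, x))) ` A = C"
    unfolding G(4)[symmetric] H(4)[symmetric] image_image by (rule refl)
  ultimately show ?thesis
    unfolding ambient_isotopic_def
    by (intro exI[of _ "\<lambda>z. G (fst z, H z)"]) (use H(3) G(3) in auto)
qed

text \<open>Sends \<open>(a, b, 1)\<close> to the vertical unit vector, so that projecting along
  \<open>(a, b, 1)\<close> becomes \<open>proj_xy\<close> after an ambient isotopy.\<close>

definition shear :: "real \<Rightarrow> real \<Rightarrow> pt3 \<Rightarrow> pt3" where
  "shear a b = (\<lambda>(x, y, z). (x - a * z, y - b * z, z))"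

lemma homeomorphism_UNIV_I:
  assumes "continuous_on UNIV f" "continuous_on UNIV g" "\<And>x. g (f x) = x" "\<And>y. f (g y) = y"
  shows "homeomorphism UNIV UNIV f g"
  unfolding homeomorphism_def using assms by (metis UNIV_I subset_antisym subset_UNIV surjI)

lemma ambient_isotopic_shear: "ambient_isotopic A (shear a b ` A)"
proof -
  have "homeomorphism UNIV UNIV (shear a b) (shear (-a) (-b))" for a b
    by (rule homeomorphism_UNIV_I)
       (auto simp: shear_def case_prod_unfold intro!: continuous_intros)
  moreover have "continuous_on ({0..1} \<times> UNIV) (\<lambda>z. shear (fst z * a) (fst z * b) (snd z))"
    by (auto simp: shear_def case_prod_unfold intro!: continuous_intros)
  ultimately show ?thesis
    unfolding ambient_isotopic_def
    by (intro exI[of _ "\<lambda>z. shear (fst z * a) (fst z * b) (snd z)"]) (auto simp: shear_def)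
qed

text \<open>The point at height \<open>z + c\<close> on the line through the origin and
  \<open>(x, y, 1)\<close>. Where this height is positive, the radial projection of the image
  depends on \<open>x\<close> and \<open>y\<close> only.\<close>

definition cone_map :: "real \<Rightarrow> pt3 \<Rightarrow> pt3" where
  "cone_map c = (\<lambda>(x, y, z). (z + c) *\<^sub>R (x, y, 1))"

text \<open>\<open>cone_map c\<close> collapses the plane at height \<open>- c\<close>, so it cannot
  itself end an isotopy of space. Replacing the factor \<open>z + c\<close> by
  \<open>max 1 (z + c)\<close> changes nothing on \<open>A\<close> and keeps the interpolated scale
  \<open>m\<close> positive everywhere. Each horizontal plane is then scaled and translated
  vertically, which is invertible.\<close>

lemma ambient_isotopic_cone_map:
  assumes "\<And>x y z. (x, y, z) \<in> A \<Longrightarrow> 1 \<le> z + c"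
  shows "ambient_isotopic A (cone_map c ` A)"
proof -
  define m where "m = (\<lambda>t z. 1 - t + t * max 1 (z + c))"
  define H :: "real \<times> pt3 \<Rightarrow> pt3"
    where "H = (\<lambda>(t, x, y, z). (m t z * x, m t z * y, z + t * c))"
  have mpos: "m t z > 0" if "t \<in> {0..1}" for t z
  proof -
    have "m t z = 1 + t * (max 1 (z + c) - 1)"
      by (simp add: m_def algebra_simps)
    with that show ?thesis
      by (smt (verit) atLeastAtMost_iff mult_nonneg_nonneg)
  qed
  have "\<exists>g. homeomorphism UNIV UNIV (\<lambda>x. H (t, x)) g" if t: "t \<in> {0..1}" for t
  proof (intro exI homeomorphism_UNIV_I)
    define g where "g = (\<lambda>(x, y, z). (x / m t (z - t * c), y / m t (z - t * c), z - t * c))"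
    have [simp]: "m t z \<noteq> 0" for z
      using mpos[OF t, of z] by simp
    show "continuous_on UNIV (\<lambda>x. H (t, x))" "continuous_on UNIV g"
      by (auto simp: H_def g_def m_def[symmetric] case_prod_unfold intro!: continuous_intros) 
         (auto simp: m_def intro!: continuous_intros)
    show "g (H (t, x)) = x" "H (t, g x) = x" for x
      by (auto simp: H_def g_def case_prod_unfold)
  qed
  moreover have "continuous_on ({0..1} \<times> UNIV) H"
    by (auto simp: H_def m_def case_prod_unfold intro!: continuous_intros)
  moreover have "H (0, x) = x" for x
    by (cases x) (simp add: H_def m_def)
  moreover have "H (1, x) = cone_map c x" if "x \<in> A" for x
    using assms that by (cases x) (fastforce simp: H_def m_def cone_map_def max_def)
  then have "(\<lambda>x. H (1, x)) ` A = cone_map c ` A"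
    by (auto simp: image_iff)
  ultimately show ?thesis
    unfolding ambient_isotopic_def by blast
qed

section \<open>Joining edges\<close>

lemma poly_edges_simps [simp]:
  "length (poly_edges ws) = length ws"
  "i < length ws \<Longrightarrow> poly_edges ws ! i = linepath (ws ! i) (ws ! (Suc i mod length ws))"
  by (auto simp: poly_edges_def)

lemma join_list_continuous:
  assumes "es \<noteq> []" "\<forall>i<length es. continuous_on {0..1} (es ! i)"
    and "\<forall>i. Suc i < length es \<longrightarrow> (es ! i) 1 = (es ! Suc i) 0"
  shows "path (join_list es) \<and> pathstart (join_list es) = (es ! 0) 0 \<and>
    pathfinish (join_list es) = (es ! (length es - 1)) 1"
  using assms
proof (induction es rule: join_list.induct)
  case (3 e f es)
  have IH: "path (join_list (f # es)) \<and> pathstart (join_list (f # es)) = ((f # es) ! 0) 0 \<and>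
    pathfinish (join_list (f # es)) = ((f # es) ! (length (f # es) - 1)) 1"
  proof (rule "3.IH")
    show "\<forall>i<length (f # es). continuous_on {0..1} ((f # es) ! i)"
      using "3.prems"(2) by force
    show "\<forall>i. Suc i < length (f # es) \<longrightarrow> ((f # es) ! i) 1 = ((f # es) ! Suc i) 0"
      using "3.prems"(3) by force
  qed simp
  then have "path e" "pathfinish e = pathstart (join_list (f # es))"
    using "3.prems"(2)[rule_format, of 0] "3.prems"(3)[rule_format, of 0] IH
    by (auto simp: path_def pathfinish_def)
  then show ?case
    using IH by (simp add: pathstart_def[of e])
qed (auto simp: path_def pathstart_def pathfinish_def)

lemma join_list_map:
  assumes "es \<noteq> []"
  shows "join_list (map (\<lambda>e. f \<circ> e) es) = f \<circ> join_list es"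
  using assms by (induction es rule: join_list.induct) (auto simp: joinpaths_def)

text \<open>\<open>R\<close> stands in for equality because the two curves live in different spaces.
  Injectivity of \<open>f\<close> is what later transfers simplicity from one curve to the
  other.\<close>

definition reparam :: "('a \<Rightarrow> 'b \<Rightarrow> bool) \<Rightarrow> (real \<Rightarrow> 'a) \<Rightarrow> (real \<Rightarrow> 'b) \<Rightarrow> (real \<Rightarrow> real) \<Rightarrow> bool" where
  "reparam R e e' f \<longleftrightarrow> continuous_on {0..1} f \<and> inj_on f {0..1} \<and> f ` {0..1} \<subseteq> {0..1} \<and>
     f 0 = 0 \<and> f 1 = 1 \<and> (\<forall>t\<in>{0..1}. R (e t) (e' (f t)))"

lemma half_eq: "(2 + 2 * x) / 2 - 1 = (x :: real)"
  by (simp add: field_simps)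

lemma reparam_join:
  assumes "reparam R e e' f" "reparam R d d' g"
  shows "\<exists>h. reparam R (e +++ d) (e' +++ d') h"
proof
  define h where "h = (\<lambda>t. f t / 2) +++ (\<lambda>t. (1 + g t) / 2)"
  have f: "continuous_on {0..1} f" "inj_on f {0..1}" "f ` {0..1} \<subseteq> {0..1}"
     "f 0 = 0" "f 1 = 1" "\<And>t. t \<in> {0..1} \<Longrightarrow> R (e t) (e' (f t))"
    using assms(1) unfolding reparam_def by auto
  have g: "continuous_on {0..1} g" "inj_on g {0..1}" "g ` {0..1} \<subseteq> {0..1}"
     "g 0 = 0" "g 1 = 1" "\<And>t. t \<in> {0..1} \<Longrightarrow> R (d t) (d' (g t))"
    using assms(2) unfolding reparam_def by auto
  have fI: "f t \<in> {0..1}" and gI: "g t \<in> {0..1}" if "t \<in> {0..1}" for t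
    using that f(3) g(3) by blast+
  have "continuous_on {0..1} h"
    unfolding h_def path_def[symmetric]
    by (rule path_join_imp)
       (auto simp: path_def pathstart_def pathfinish_def f g intro!: continuous_intros)
  moreover have "h 0 = 0" "h 1 = 1"
    by (auto simp: h_def joinpaths_def f g)
  moreover have "h ` {0..1} \<subseteq> {0..1}"
  proof clarify
    fix t :: real assume "t \<in> {0..1}"
    then show "h t \<in> {0..1}"
      using fI[of "2 * t"] gI[of "2 * t - 1"] by (auto simp: h_def joinpaths_def)
  qed
  \<comment> \<open>The two halves of \<open>h\<close> take values on either side of 1/2, so a
    common value is 1/2 and \<open>g\<close> would vanish away from 0.\<close>
  moreover have half: False if "t \<in> {0..1}" "s \<in> {0..1}" "t \<le> 1/2" "\<not> s \<le> 1/2" "h t = h s" for t s :: real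
  proof -
    have "g (2 * s - 1) = 0"
      using that fI[of "2 * t"] gI[of "2 * s - 1"] by (auto simp: h_def joinpaths_def)
    then have "2 * s - 1 = 0"
      using inj_onD[OF g(2), of "2 * s - 1" 0] that g(4) by auto
    then show False
      using that by simp
  qed
  moreover have "inj_on h {0..1}"
  proof (rule inj_onI)
    fix t s :: real assume ts: "t \<in> {0..1}" "s \<in> {0..1}" "h t = h s"
    consider "t \<le> 1/2" "s \<le> 1/2" | "\<not> t \<le> 1/2" "\<not> s \<le> 1/2"
      using half[of t s] half[of s t] ts by argo
    then show "t = s"
    proof cases
      case 1
      then show ?thesis
        using inj_onD[OF f(2), of "2 * t" "2 * s"] ts by (auto simp: h_def joinpaths_def)
    next
      case 2
      then show ?thesis
        using inj_onD[OF g(2), of "2 * t - 1" "2 * s - 1"] ts by (auto simp: h_def joinpaths_def)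
    qed
  qed
  moreover have "R ((e +++ d) t) ((e' +++ d') (h t))" if t: "t \<in> {0..1}" for t
  proof (cases "t \<le> 1/2")
    case True
    then show ?thesis
      using f(6)[of "2 * t"] fI[of "2 * t"] t by (auto simp: h_def joinpaths_def)
  next
    case False
    \<comment> \<open>Otherwise \<open>h t\<close> would be 1/2, where \<open>e' +++ d'\<close>
      still evaluates \<open>e'\<close>. Hence no agreement between the end of \<open>e\<close> and
      the start of \<open>d\<close> has to be assumed.\<close>
    have "g (2 * t - 1) \<noteq> 0"
      using inj_onD[OF g(2), of "2 * t - 1" 0] t False g(4) by auto
    then show ?thesis
      using g(6)[of "2 * t - 1"] gI[of "2 * t - 1"] False t by (auto simp: h_def joinpaths_def half_eq)
  qed
  ultimately show "reparam R (e +++ d) (e' +++ d') h"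
    unfolding reparam_def by blast
qed

lemma reparam_join_list:
  assumes "list_all2 (\<lambda>e e'. \<exists>f. reparam R e e' f) es es'" "es \<noteq> []"
  shows "\<exists>f. reparam R (join_list es) (join_list es') f"
  using assms
proof (induction es es' rule: list_all2_induct)
  case (Cons e es e' es')
  then show ?case
    by (cases es; cases es') (auto intro: reparam_join)
qed simp

text \<open>The parameter at which \<open>join_list\<close> of \<open>n\<close> edges runs through the point \<open>s\<close> of edge \<open>i\<close>:
  each join spends half of the remaining time on its first edge.\<close>
fun join_param :: "nat \<Rightarrow> nat \<Rightarrow> real \<Rightarrow> real" where
  "join_param (Suc (Suc n)) 0 s = s / 2"
| "join_param (Suc (Suc n)) (Suc i) s = (1 + join_param (Suc n) i s) / 2"
| "join_param _ i s = s"

lemma join_param_range: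
  assumes "s \<in> {0..1}"
  shows "join_param n i s \<in> {0..1}"
  using assms by (induction n i s rule: join_param.induct) auto

lemma join_param_eq_0:
  assumes "s \<in> {0..1}" "i < n" "join_param n i s = 0"
  shows "i = 0 \<and> s = 0"
  using assms
proof (induction n i s rule: join_param.induct)
  case (2 n i s)
  then show ?case
    using join_param_range[of s "Suc n" i] by auto
qed auto

lemma join_param_eq_1:
  assumes "s \<in> {0..1}" "i < n" "join_param n i s = 1"
  shows "Suc i = n \<and> s = 1"
  using assms by (induction n i s rule: join_param.induct) auto

lemma join_param_inj:
  assumes "s \<in> {0..1}" "t \<in> {0..1}" "i < n" "j < n" "join_param n i s = join_param n j t"
  shows "i = j \<and> s = t \<or> j = Suc i \<and> s = 1 \<and> t = 0 \<or> i = Suc j \<and> t = 1 \<and> s = 0"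
  using assms
proof (induction n i s arbitrary: j rule: join_param.induct)
  case (1 n s)
  show ?case
  proof (cases j)
    case (Suc j')
    then show ?thesis
      using 1 join_param_range[of t "Suc n" j'] join_param_eq_0[of t j' "Suc n"] by auto
  qed (use 1 in auto)
next
  case (2 n i s)
  show ?case
  proof (cases j)
    case 0
    then show ?thesis
      using 2 join_param_range[of s "Suc n" i] join_param_eq_0[of s i "Suc n"] by auto
  next
    case (Suc j')
    then show ?thesis
      using 2 by auto
  qed
qed auto

lemma join_list_param:
  assumes "\<forall>i. Suc i < length es \<longrightarrow> (es ! i) 1 = (es ! Suc i) 0"
    and "i < length es" "s \<in> {0..1}"
  shows "join_list es (join_param (length es) i s) = (es ! i) s"
  using assms
proof (induction es arbitrary: i rule: join_list.induct)
  case (3 e f es)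
  show ?case
  proof (cases i)
    case 0
    then show ?thesis
      using 3 by (simp add: joinpaths_def)
  next
    case (Suc k)
    let ?p = "join_param (length (f # es)) k s"
    have IH: "join_list (f # es) ?p = ((f # es) ! k) s"
    proof (rule "3.IH")
      show "\<forall>i. Suc i < length (f # es) \<longrightarrow> ((f # es) ! i) 1 = ((f # es) ! Suc i) 0"
        using "3.prems"(1) by force
    qed (use "3.prems" Suc in auto)
    have p: "?p \<in> {0..1}"
      using "3.prems" join_param_range by blast
    show ?thesis
    \<comment> \<open>Here the joined parameter is 1/2, where the join takes its first branch and
      returns the end of \<open>e\<close>; only the linking hypothesis identifies this with the
      start of \<open>f\<close>.\<close>
    proof (cases "?p = 0")
      case True
      then have "k = 0" "s = 0"
        using join_param_eq_0[of s k "length (f # es)"] "3.prems" Suc by auto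
      then show ?thesis
        using "3.prems"(1)[rule_format, of 0] Suc True by (simp add: joinpaths_def)
    next
      case False
      then have "\<not> (1 + ?p) / 2 \<le> 1 / 2"
        using p by auto
      then show ?thesis
        using Suc IH by (simp add: joinpaths_def half_eq)
    qed
  qed
qed (auto simp: less_Suc_eq)

text \<open>Simplicity of the loop in edge coordinates. Equal points have equal joined parameters,
  which allows only a junction of consecutive edges, or the parameters 0 and 1, which is the
  junction of the last edge with the first and accounts for the \<open>mod\<close>.\<close>

lemma simple_closed_join_list:
  assumes simple: "simple_path (join_list es)"
    and link: "\<forall>i. Suc i < length es \<longrightarrow> (es ! i) 1 = (es ! Suc i) 0"
    and "i < length es" "j < length es" "s \<in> {0..1}" "t \<in> {0..1}" "(es ! i) s = (es ! j) t"
  shows "i = j \<and> s = t \<or> j = Suc i mod length es \<and> s = 1 \<and> t = 0 \<or>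
    i = Suc j mod length es \<and> t = 1 \<and> s = 0"
proof -
  let ?n = "length es"
  let ?p = "join_param ?n i s" and ?q = "join_param ?n j t"
  have "join_list es ?p = join_list es ?q"
    using assms by (simp add: join_list_param)
  then consider "?p = ?q" | "?p = 0" "?q = 1" | "?p = 1" "?q = 0"
    using simple join_param_range[OF assms(5), of ?n i] join_param_range[OF assms(6), of ?n j]
    unfolding simple_path_def loop_free_def by metis
  then show ?thesis
  proof cases
    case 1
    then show ?thesis
      using join_param_inj[OF assms(5,6,3,4)] assms(3,4) by (auto simp: mod_less)
  next
    case 2
    then show ?thesis
      using join_param_eq_0[OF assms(5,3)] join_param_eq_1[OF assms(6,4)] by auto
  next
    case 3
    then show ?thesis
      using join_param_eq_1[OF assms(5,3)] join_param_eq_0[OF assms(6,4)] by auto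
  qed
qed

section \<open>Central projection of a segment\<close>

definition lift1 :: "pt2 \<Rightarrow> pt3" where
  "lift1 w = (fst w, snd w, 1)"

lemma norm_lift1_pos [simp]: "norm (lift1 w) > 0" "lift1 w \<noteq> 0"
  by (auto simp: lift1_def prod_eq_iff)

text \<open>Gram-Schmidt applied to \<open>W\<close> and \<open>Z\<close>, together with the angle
  between them; \<open>arccos\<close> selects the shorter of the two great circle arcs.\<close>

definition gc_of :: "pt3 \<Rightarrow> pt3 \<Rightarrow> pt3 \<times> pt3 \<times> real" where
  "gc_of W Z = (let a = W /\<^sub>R norm W; v = Z - (Z \<bullet> a) *\<^sub>R a in
     (a, v /\<^sub>R norm v, arccos (Z \<bullet> a / norm Z)))"

lemma norm_orthonormal_comb:
  fixes a u :: "'a::real_inner"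
  assumes "norm a = 1" "norm u = 1" "a \<bullet> u = 0"
  shows "(norm (x *\<^sub>R a + y *\<^sub>R u))\<^sup>2 = x\<^sup>2 + y\<^sup>2"
proof -
  have "a \<bullet> a = 1" "u \<bullet> u = 1"
    using assms by (simp_all flip: power2_norm_eq_inner)
  then show ?thesis
    using assms unfolding power2_norm_eq_inner
    by (simp add: inner_add_left inner_add_right inner_commute[of u a] power2_eq_square)
qed

lemma angle_fraction:
  fixes th s :: real
  assumes "0 < th" "th < pi" "s \<in> {0..1}"
  shows "0 \<le> th * s" "th * s < pi"
proof -
  have "th * s \<le> th * 1"
    using assms by (intro mult_left_mono) auto
  then show "th * s < pi"
    using assms(2) by linarith
  show "0 \<le> th * s"
    using assms by simp
qed

text \<open>Polar coordinates in the plane spanned by \<open>W\<close> and \<open>Z\<close>. As they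
  are not parallel, the orthogonal part \<open>v\<close> is nonzero, and Pythagoras then keeps the
  cosine strictly between -1 and 1; hence \<open>th\<close> is strictly between 0 and pi.\<close>

lemma gc_of_decomp:
  fixes W Z :: pt3
  assumes "W \<noteq> 0" "\<And>k. Z \<noteq> k *\<^sub>R W"
  obtains a u th A B where "gc_of W Z = (a, u, th)" "norm a = 1" "norm u = 1" "a \<bullet> u = 0"
    "0 < th" "th < pi" "A > 0" "B > 0" "W = A *\<^sub>R a" "Z = (B * cos th) *\<^sub>R a + (B * sin th) *\<^sub>R u"
proof -
  define a where "a = W /\<^sub>R norm W"
  define v where "v = Z - (Z \<bullet> a) *\<^sub>R a"
  define u where "u = v /\<^sub>R norm v"
  define th where "th = arccos (Z \<bullet> a / norm Z)"
  have a: "norm a = 1" "W = norm W *\<^sub>R a" "a \<bullet> a = 1"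
    using assms(1) by (auto simp: a_def simp flip: power2_norm_eq_inner)
  have v0: "v \<noteq> 0"
  proof
    assume "v = 0"
    then have "Z = ((Z \<bullet> a) / norm W) *\<^sub>R W"
      by (simp add: v_def a_def divide_inverse)
    with assms(2) show False by blast
  qed
  have Z0: "Z \<noteq> 0"
    using assms(2)[of 0] by auto
  have av: "a \<bullet> v = 0"
    by (simp add: v_def inner_diff_right a inner_commute)
  have Z: "Z = (Z \<bullet> a) *\<^sub>R a + v"
    by (simp add: v_def)
  have "(norm Z)\<^sup>2 = Z \<bullet> Z"
    by (simp add: power2_norm_eq_inner)
  also have "\<dots> = (Z \<bullet> a)\<^sup>2 + v \<bullet> v"
    by (subst (1 2) Z) (simp add: inner_add_left inner_add_right a av inner_commute[of v a] power2_eq_square)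
  finally have pyth: "(norm Z)\<^sup>2 = (Z \<bullet> a)\<^sup>2 + (norm v)\<^sup>2"
    by (simp add: power2_norm_eq_inner)
  then have "(Z \<bullet> a)\<^sup>2 = (norm Z)\<^sup>2 - (norm v)\<^sup>2"
    by simp
  then have "(Z \<bullet> a / norm Z)\<^sup>2 = 1 - (norm v / norm Z)\<^sup>2"
    using Z0 by (simp add: power_divide diff_divide_distrib)
  moreover have "(norm v / norm Z)\<^sup>2 > 0"
    using v0 Z0 by simp
  ultimately have sq: "(Z \<bullet> a / norm Z)\<^sup>2 < 1" "1 - (Z \<bullet> a / norm Z)\<^sup>2 = (norm v / norm Z)\<^sup>2"
    by auto
  then have c: "-1 < Z \<bullet> a / norm Z" "Z \<bullet> a / norm Z < 1"
    using abs_square_less_1[of "Z \<bullet> a / norm Z"] by linarith+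
  have "cos th = Z \<bullet> a / norm Z" "sin th = norm v / norm Z"
    using c sq(2) unfolding th_def by (auto simp: sin_arccos)
  moreover have "0 < th" "th < pi"
    using arccos_lt_bounded[OF c] by (auto simp: th_def)
  moreover have "gc_of W Z = (a, u, th)"
    by (simp add: gc_of_def a_def v_def u_def th_def Let_def)
  moreover have "norm u = 1" "a \<bullet> u = 0"
    using v0 av by (auto simp: u_def)
  ultimately show thesis
    using that[of a u th "norm W" "norm Z"] a assms(1) Z0 Z v0 by (auto simp: u_def)
qed

text \<open>By the sine rule, the point at angle \<open>\<alpha>\<close> along the arc lies on the ray through the point of
  the segment with parameter \<open>A sin \<alpha> / (A sin \<alpha> + B sin (th - \<alpha>))\<close>.\<close>
lemma segment_ray_parameter:
  fixes a u :: "'a::real_normed_vector"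
  assumes "A > 0" "B > 0" "0 < th" "th < pi" "t \<in> {0..1}"
  defines "D \<equiv> A * sin (th * t) + B * sin (th * (1 - t))"
  shows "D > 0"
    and "cos (th * t) *\<^sub>R a + sin (th * t) *\<^sub>R u = (D / (A * B * sin th)) *\<^sub>R
      linepath (A *\<^sub>R a) ((B * cos th) *\<^sub>R a + (B * sin th) *\<^sub>R u) (A * sin (th * t) / D)"
proof -
  have s0: "sin (th * s) \<ge> 0" if "s \<in> {0..1}" for s
    using angle_fraction[OF assms(3,4) that] by (intro sin_ge_zero) auto
  have s1: "sin (th * s) > 0" if "s \<in> {0<..1}" for s
    using angle_fraction[OF assms(3,4), of s] that assms(3) by (intro sin_gt_zero) auto
  show D: "D > 0"
  proof (cases "t = 0")
    case True
    then show ?thesis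
      using assms s1[of 1] by (simp add: D_def)
  next
    case False
    then show ?thesis
      using assms s1[of t] s0[of "1 - t"] unfolding D_def
      by (intro add_pos_nonneg) auto
  qed
  let ?s = "A * sin (th * t) / D" and ?k = "D / (A * B * sin th)"
  have sth: "sin th > 0"
    using s1[of 1] by simp
  have sd: "sin (th * (1 - t)) = sin th * cos (th * t) - cos th * sin (th * t)"
    by (simp add: right_diff_distrib sin_diff)
  \<comment> \<open>It suffices to compare the coefficients of \<open>a\<close> and
    \<open>u\<close>. The one of \<open>a\<close> needs the subtraction formula \<open>sd\<close>;
    the one of \<open>u\<close> is a cancellation.\<close>
  have 1: "?k * ((1 - ?s) * A + ?s * (B * cos th)) = cos (th * t)"
  proof -
    have Ds: "D * ?s = A * sin (th * t)"
      using D by simp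
    have "D * ((1 - ?s) * A + ?s * (B * cos th)) = (D - D * ?s) * A + D * ?s * (B * cos th)"
      by (simp only: algebra_simps)
    then have "?k * ((1 - ?s) * A + ?s * (B * cos th)) =
        ((D - A * sin (th * t)) * A + A * sin (th * t) * (B * cos th)) / (A * B * sin th)"
      unfolding Ds by (metis times_divide_eq_left)
    also have "(D - A * sin (th * t)) * A + A * sin (th * t) * (B * cos th) = cos (th * t) * (A * B * sin th)"
      unfolding D_def sd by (simp add: algebra_simps)
    finally show ?thesis
      using assms(1,2) sth by simp
  qed
  have 2: "?k * (?s * (B * sin th)) = sin (th * t)"
    using D assms(1,2) sth by simp
  have "?k *\<^sub>R linepath (A *\<^sub>R a) ((B * cos th) *\<^sub>R a + (B * sin th) *\<^sub>R u) ?s =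
      (?k * ((1 - ?s) * A + ?s * (B * cos th))) *\<^sub>R a + (?k * (?s * (B * sin th))) *\<^sub>R u"
    unfolding linepath_def by (simp add: scaleR_add_left scaleR_add_right distrib_left)
  then show "cos (th * t) *\<^sub>R a + sin (th * t) *\<^sub>R u = ?k *\<^sub>R
      linepath (A *\<^sub>R a) ((B * cos th) *\<^sub>R a + (B * sin th) *\<^sub>R u) ?s"
    unfolding 1 2 by simp
qed

text \<open>The component along \<open>a\<close> is \<open>cos (th * t)\<close>, and the angle stays
  in the interval from 0 to pi, where cosine is injective.\<close>

lemma gc_arc_inj:
  assumes "norm a = 1" "norm u = 1" "a \<bullet> u = 0" "0 < th" "th < pi"
  shows "inj_on (gc_arc a u th) {0..1}"
proof (rule inj_onI)
  fix s t :: real assume st: "s \<in> {0..1}" "t \<in> {0..1}" "gc_arc a u th s = gc_arc a u th t"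
  have "gc_arc a u th x \<bullet> a = cos (th * x)" for x
    using assms by (simp add: gc_arc_def inner_add_left inner_commute[of u a] flip: power2_norm_eq_inner)
  then have "cos (th * s) = cos (th * t)"
    using st(3) by metis
  moreover have "th * x \<in> {0..pi}" if "x \<in> {0..1}" for x
    using angle_fraction[OF assms(4,5) that] by auto
  ultimately have "th * s = th * t"
    using st cos_inj_pi[of "th * s" "th * t"] by (meson atLeastAtMost_iff)
  then show "s = t"
    using assms by simp
qed

lemma cross3_comb: "cross3 (p *\<^sub>R a) (x *\<^sub>R a + y *\<^sub>R u) = (p * y) *\<^sub>R cross3 a u"
proof -
  obtain a1 a2 a3 u1 u2 u3 where "a = (a1, a2, a3)" "u = (u1, u2, u3)"
    by (metis prod_cases3)
  then show ?thesis
    by (simp add: cross3_def) (simp add: algebra_simps)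
qed

lemma linepath_lift1: "linepath (lift1 v) (lift1 w) t = lift1 (linepath v w t)"
  by (simp add: linepath_def lift1_def)

text \<open>All that is needed about a single edge. Since \<open>lift1 p\<close> has height 1, the
  relation in the last clause says that \<open>c\<close> lies on the open ray through
  \<open>lift1 p\<close>, its height being the scale factor. The normal is needed only up to a
  nonzero factor, which is enough for transversality.\<close>

lemma gc_of_reparam:
  assumes "v \<noteq> w"
  shows "valid_arc (gc_of (lift1 v) (lift1 w))"
    and "inj_on (arc_path (gc_of (lift1 v) (lift1 w))) {0..1}"
    and "continuous_on {0..1} (arc_path (gc_of (lift1 v) (lift1 w)))"
    and "arc_path (gc_of (lift1 v) (lift1 w)) 0 = lift1 v /\<^sub>R norm (lift1 v)"
    and "arc_path (gc_of (lift1 v) (lift1 w)) 1 = lift1 w /\<^sub>R norm (lift1 w)"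
    and "\<exists>k\<noteq>0. arc_normal (gc_of (lift1 v) (lift1 w)) = k *\<^sub>R cross3 (lift1 v) (lift1 w)"
    and "\<exists>f. reparam (\<lambda>c p. snd (snd c) > 0 \<and> c = snd (snd c) *\<^sub>R lift1 p)
      (arc_path (gc_of (lift1 v) (lift1 w))) (linepath v w) f"
proof -
  \<comment> \<open>Both points have height 1, so a multiple could only be the point itself.\<close>
  have "lift1 w \<noteq> k *\<^sub>R lift1 v" for k
    using assms by (auto simp: lift1_def prod_eq_iff)
  then obtain a u th A B where g: "gc_of (lift1 v) (lift1 w) = (a, u, th)"
    and au: "norm a = 1" "norm u = 1" "a \<bullet> u = 0" and th: "0 < th" "th < pi" and AB: "A > 0" "B > 0"
    and v: "lift1 v = A *\<^sub>R a" and w: "lift1 w = (B * cos th) *\<^sub>R a + (B * sin th) *\<^sub>R u"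
    using gc_of_decomp[of "lift1 v" "lift1 w"] by (metis norm_lift1_pos(2))
  have sth: "sin th > 0"
    using th by (simp add: sin_gt_zero)
  show "valid_arc (gc_of (lift1 v) (lift1 w))"
    using g au th by (simp add: valid_arc_def)
  have p: "arc_path (gc_of (lift1 v) (lift1 w)) = gc_arc a u th"
    by (simp add: g arc_path_def)
  show inj: "inj_on (arc_path (gc_of (lift1 v) (lift1 w))) {0..1}"
    unfolding p by (rule gc_arc_inj) (use au th in auto)
  show cont: "continuous_on {0..1} (arc_path (gc_of (lift1 v) (lift1 w)))"
    unfolding p gc_arc_def by (intro continuous_intros)
  show "arc_path (gc_of (lift1 v) (lift1 w)) 0 = lift1 v /\<^sub>R norm (lift1 v)"
    unfolding p using AB au by (simp add: gc_arc_def v)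
  have "(norm (lift1 w))\<^sup>2 = (B * cos th)\<^sup>2 + (B * sin th)\<^sup>2"
    unfolding w by (rule norm_orthonormal_comb[OF au])
  also have "\<dots> = B\<^sup>2 * ((cos th)\<^sup>2 + (sin th)\<^sup>2)"
    by (simp only: power_mult_distrib distrib_left)
  finally have "norm (lift1 w) = B"
    using AB by simp
  then show "arc_path (gc_of (lift1 v) (lift1 w)) 1 = lift1 w /\<^sub>R norm (lift1 w)"
    unfolding p using AB by (simp add: gc_arc_def w scaleR_add_right mult.assoc[symmetric])
  have "cross3 (lift1 v) (lift1 w) = (A * B * sin th) *\<^sub>R cross3 a u"
    unfolding v w cross3_comb by (simp add: mult.assoc)
  then show "\<exists>k\<noteq>0. arc_normal (gc_of (lift1 v) (lift1 w)) = k *\<^sub>R cross3 (lift1 v) (lift1 w)"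
    using AB sth g by (intro exI[of _ "1 / (A * B * sin th)"]) (simp add: arc_normal_def)
  define D where "D = (\<lambda>t. A * sin (th * t) + B * sin (th * (1 - t)))"
  define f where "f = (\<lambda>t. A * sin (th * t) / D t)"
  have D: "D t > 0" and arc: "gc_arc a u th t = (D t / (A * B * sin th)) *\<^sub>R lift1 (linepath v w (f t))"
    if "t \<in> {0..1}" for t
    unfolding D_def f_def gc_arc_def linepath_lift1[symmetric] v w
    by (rule segment_ray_parameter[OF AB th that])+
  have s0: "sin (th * s) \<ge> 0" if "s \<in> {0..1}" for s
    using angle_fraction[OF th that] by (intro sin_ge_zero) auto
  have arc': "snd (snd (gc_arc a u th t)) > 0 \<and>
      gc_arc a u th t = snd (snd (gc_arc a u th t)) *\<^sub>R lift1 (linepath v w (f t))"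
    if "t \<in> {0..1}" for t
  proof -
    have "snd (snd (gc_arc a u th t)) = D t / (A * B * sin th)"
      by (subst arc[OF that]) (simp add: lift1_def)
    then show ?thesis
      using arc[OF that] D[OF that] AB sth by (simp only:) simp
  qed
  have "continuous_on {0..1} f"
    unfolding f_def
  proof (intro continuous_intros ballI)
    show "continuous_on {0..1} D"
      unfolding D_def by (intro continuous_intros)
    show "D t \<noteq> 0" if "t \<in> {0..1}" for t
      using D[OF that] by simp
  qed
  \<comment> \<open>Equal values of \<open>f\<close> put two unit vectors on the same ray; they
    coincide, and the arc is injective.\<close>
  moreover have "inj_on f {0..1}"
  proof (rule inj_onI)
    fix s t :: real assume st: "s \<in> {0..1}" "t \<in> {0..1}" "f s = f t"
    let ?z = "\<lambda>t. snd (snd (gc_arc a u th t))" and ?L = "lift1 (linepath v w (f t))"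
    have n: "norm (gc_arc a u th x) = 1" for x
    proof -
      have "(norm (gc_arc a u th x))\<^sup>2 = (cos (th * x))\<^sup>2 + (sin (th * x))\<^sup>2"
        unfolding gc_arc_def by (rule norm_orthonormal_comb[OF au])
      then show ?thesis
        using power2_eq_1_iff[of "norm (gc_arc a u th x)"] norm_ge_zero[of "gc_arc a u th x"]
        by auto
    qed
    have es: "gc_arc a u th s = ?z s *\<^sub>R ?L" "gc_arc a u th t = ?z t *\<^sub>R ?L" "?z s > 0" "?z t > 0"
      using arc'[OF st(1)] arc'[OF st(2)] unfolding st(3) by blast+
    have "norm (?z s *\<^sub>R ?L) = 1" "norm (?z t *\<^sub>R ?L) = 1"
      using n[of s] n[of t] unfolding es(1)[symmetric] es(2)[symmetric] by auto
    then have "?z s * norm ?L = 1" "?z t * norm ?L = 1"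
      using es(3,4) by simp_all
    then have "?z s = ?z t"
      using mult_right_cancel[of "norm ?L" "?z s" "?z t"] by simp
    then show "s = t"
      using inj_onD[OF inj[unfolded p], of s t] es(1,2) st(1,2) by simp
  qed
  moreover have "f ` {0..1} \<subseteq> {0..1}"
  proof clarify
    fix t :: real assume t: "t \<in> {0..1}"
    then show "f t \<in> {0..1}"
      using D[OF t] s0[OF t] s0[of "1 - t"] AB by (auto simp: f_def D_def divide_simps)
  qed
  moreover have "f 0 = 0" "f 1 = 1"
    using sth AB by (auto simp: f_def D_def)
  ultimately show "\<exists>f. reparam (\<lambda>c p. snd (snd c) > 0 \<and> c = snd (snd c) *\<^sub>R lift1 p)
      (arc_path (gc_of (lift1 v) (lift1 w))) (linepath v w) f"
    unfolding reparam_def p using arc' by blast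
qed

section \<open>Central projection of a planar diagram\<close>

text \<open>The first two coordinates of \<open>cross3 (lift1 v) (lift1 v')\<close> are
  \<open>v' - v\<close> turned by a right angle, so the third coordinate of the cross product of two
  such normals is the planar determinant of the edges.\<close>

lemma cross3_lift1_neq_0:
  assumes "cross2 (v' - v) (w' - w) \<noteq> 0"
  shows "cross3 (cross3 (lift1 v) (lift1 v')) (cross3 (lift1 w) (lift1 w')) \<noteq> 0"
proof -
  have "snd (snd (cross3 (cross3 (lift1 v) (lift1 v')) (cross3 (lift1 w) (lift1 w')))) =
      cross2 (v' - v) (w' - w)"
    by (simp add: cross3_def lift1_def cross2_def algebra_simps)
  with assms show ?thesis
    by auto
qed

lemma cross3_scale: "cross3 (k *\<^sub>R u) (l *\<^sub>R v) = (k * l) *\<^sub>R cross3 u v"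
  using cross3_comb[of k u 0 l v] by simp

definition project_arcs :: "pt2 list \<Rightarrow> (pt3 \<times> pt3 \<times> real) list" where
  "project_arcs ws = map (\<lambda>i. gc_of (lift1 (ws ! i)) (lift1 (ws ! (Suc i mod length ws)))) [0..<length ws]"

lemma project_arcs_simps [simp]:
  "length (project_arcs ws) = length ws"
  "i < length ws \<Longrightarrow> project_arcs ws ! i = gc_of (lift1 (ws ! i)) (lift1 (ws ! (Suc i mod length ws)))"
  by (auto simp: project_arcs_def)

definition gnomonic :: "pt3 \<Rightarrow> pt2" where
  "gnomonic c = (fst c / snd (snd c), fst (snd c) / snd (snd c))"

lemma gnomonic_ray: "c = snd (snd c) *\<^sub>R lift1 p \<Longrightarrow> snd (snd c) > 0 \<Longrightarrow> gnomonic c = p"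
  by (cases c; cases p) (auto simp: gnomonic_def lift1_def)

context
  fixes ws :: "pt2 list" and n :: nat
  assumes ws: "planar_stick_curve ws" and n: "n = length ws"
begin

lemma planar_n: "n > 0"
  and planar_inj: "\<And>i. i < n \<Longrightarrow> inj_on (poly_edges ws ! i) {0..1}"
  and planar_vertex: "\<And>i j s. \<lbrakk>i < n; j < n; s \<in> {0..1}; (poly_edges ws ! j) s = (poly_edges ws ! i) 0\<rbrakk>
     \<Longrightarrow> (j = i \<and> s = 0) \<or> (j = (i + n - 1) mod n \<and> s = 1)"
  and planar_card: "\<And>x. card {i. i < n \<and> x \<in> (poly_edges ws ! i) ` {0..1}} \<le> 2"
  and planar_tr: "\<And>i j x. \<lbrakk>i < n; j < n; i \<noteq> j; x \<in> (poly_edges ws ! i) ` {0..1};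
     x \<in> (poly_edges ws ! j) ` {0..1}; \<And>k. k < n \<Longrightarrow> x \<noteq> (poly_edges ws ! k) 0\<rbrakk>
     \<Longrightarrow> cross2 (ws ! (Suc i mod n) - ws ! i) (ws ! (Suc j mod n) - ws ! j) \<noteq> 0"
proof -
  note reg = ws[unfolded planar_stick_curve_def regular_edge_curve_def Let_def poly_edges_simps(1) n[symmetric]]
  show "n > 0" "\<And>i. i < n \<Longrightarrow> inj_on (poly_edges ws ! i) {0..1}"
    using reg by auto
  show "\<And>i j s. \<lbrakk>i < n; j < n; s \<in> {0..1}; (poly_edges ws ! j) s = (poly_edges ws ! i) 0\<rbrakk>
     \<Longrightarrow> (j = i \<and> s = 0) \<or> (j = (i + n - 1) mod n \<and> s = 1)"
    using reg by blast
  show "\<And>x. card {i. i < n \<and> x \<in> (poly_edges ws ! i) ` {0..1}} \<le> 2"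
    using reg by blast
  show "\<And>i j x. \<lbrakk>i < n; j < n; i \<noteq> j; x \<in> (poly_edges ws ! i) ` {0..1};
     x \<in> (poly_edges ws ! j) ` {0..1}; \<And>k. k < n \<Longrightarrow> x \<noteq> (poly_edges ws ! k) 0\<rbrakk>
     \<Longrightarrow> cross2 (ws ! (Suc i mod n) - ws ! i) (ws ! (Suc j mod n) - ws ! j) \<noteq> 0"
    using reg unfolding Suc_eq_plus1 by blast
qed

lemma planar_neq: "i < n \<Longrightarrow> ws ! i \<noteq> ws ! (Suc i mod n)"
  using inj_onD[OF planar_inj, of i 0 1] n by (auto simp: linepath_def)

lemmas arc_facts = gc_of_reparam[OF planar_neq]

abbreviation "arcs \<equiv> map arc_path (project_arcs ws)"

lemma arcs_nth: "i < n \<Longrightarrow> arcs ! i = arc_path (gc_of (lift1 (ws ! i)) (lift1 (ws ! (Suc i mod n))))"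
  using n by simp

lemma arcs_reparam:
  assumes "i < n"
  shows "\<exists>f. reparam (\<lambda>c p. snd (snd c) > 0 \<and> c = snd (snd c) *\<^sub>R lift1 p) (arcs ! i) (poly_edges ws ! i) f"
  using arc_facts(7)[OF assms] assms n by simp

lemma arcs_points:
  assumes "i < n"
  obtains f where "inj_on f {0..1}" "f 0 = 0" "f 1 = 1" "\<And>t. t \<in> {0..1} \<Longrightarrow> f t \<in> {0..1}"
    "\<And>t. t \<in> {0..1} \<Longrightarrow> snd (snd ((arcs ! i) t)) > 0"
    "\<And>t. t \<in> {0..1} \<Longrightarrow> (arcs ! i) t = snd (snd ((arcs ! i) t)) *\<^sub>R lift1 ((poly_edges ws ! i) (f t))"
proof -
  obtain f where "reparam (\<lambda>c p. snd (snd c) > 0 \<and> c = snd (snd c) *\<^sub>R lift1 p) (arcs ! i) (poly_edges ws ! i) f"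
    using arcs_reparam[OF assms] by blast
  then show thesis
    unfolding reparam_def by (intro that[of f]) blast+
qed

lemma gnomonic_arc_image:
  assumes "i < n" "x \<in> (arcs ! i) ` {0..1}"
  shows "gnomonic x \<in> (poly_edges ws ! i) ` {0..1}"
proof -
  obtain f where f: "\<And>t. t \<in> {0..1} \<Longrightarrow> f t \<in> {0..1}"
    "\<And>t. t \<in> {0..1} \<Longrightarrow> snd (snd ((arcs ! i) t)) > 0"
    "\<And>t. t \<in> {0..1} \<Longrightarrow> (arcs ! i) t = snd (snd ((arcs ! i) t)) *\<^sub>R lift1 ((poly_edges ws ! i) (f t))"
    using arcs_points[OF assms(1)] by metis
  obtain t where t: "t \<in> {0..1}" "x = (arcs ! i) t"
    using assms(2) by blast
  then have "gnomonic x = (poly_edges ws ! i) (f t)"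
    using f gnomonic_ray by metis
  then show ?thesis
    using f t by blast
qed

lemma arcs_start: "i < n \<Longrightarrow> (arcs ! i) 0 = lift1 (ws ! i) /\<^sub>R norm (lift1 (ws ! i))"
  using arc_facts(4) arcs_nth by simp

text \<open>Arc points are unit vectors in the upper half space, so each is determined by its image
  under \<open>gnomonic\<close>. This carries planar coincidences back to the sphere.\<close>

lemma arc_upper:
  assumes "i < n" "x \<in> (arcs ! i) ` {0..1}"
  shows "snd (snd x) > 0" "x = (1 / norm (lift1 (gnomonic x))) *\<^sub>R lift1 (gnomonic x)"
proof -
  obtain t where t: "t \<in> {0..1}" "x = (arcs ! i) t"
    using assms(2) by blast
  obtain f where f: "snd (snd ((arcs ! i) t)) > 0"
    "(arcs ! i) t = snd (snd ((arcs ! i) t)) *\<^sub>R lift1 ((poly_edges ws ! i) (f t))"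
    using arcs_points[OF assms(1)] t(1) by metis
  show pos: "snd (snd x) > 0"
    using f t by simp
  have x: "x = snd (snd x) *\<^sub>R lift1 (gnomonic x)"
    using f t gnomonic_ray by metis
  obtain a u th where g: "gc_of (lift1 (ws ! i)) (lift1 (ws ! (Suc i mod n))) = (a, u, th)"
    using prod_cases3 by blast
  have au: "norm a = 1" "norm u = 1" "a \<bullet> u = 0"
    using arc_facts(1)[OF assms(1)] g by (auto simp: valid_arc_def)
  have "(norm x)\<^sup>2 = 1"
    unfolding t(2) arcs_nth[OF assms(1)] g arc_path_def prod.case gc_arc_def norm_orthonormal_comb[OF au]
    by simp
  then have "norm x = 1"
    using power2_eq_1_iff[of "norm x"] norm_ge_zero[of x] by auto
  then have "norm (snd (snd x) *\<^sub>R lift1 (gnomonic x)) = 1"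
    using x by simp
  then have "snd (snd x) * norm (lift1 (gnomonic x)) = 1"
    using pos by simp
  then have "snd (snd x) = 1 / norm (lift1 (gnomonic x))"
    by (simp add: nonzero_eq_divide_eq)
  with x show "x = (1 / norm (lift1 (gnomonic x))) *\<^sub>R lift1 (gnomonic x)"
    by simp
qed

text \<open>\<open>gnomonic\<close> turns every incidence between arcs into one between the
  corresponding segments, where regularity of the planar curve applies.\<close>

lemma spherical_stick_curve_project: "spherical_stick_curve (project_arcs ws)"
proof -
  have valid: "\<forall>A\<in>set (project_arcs ws). valid_arc A"
    using arc_facts(1) n by (auto simp: project_arcs_def)
  have cont: "\<forall>i<n. continuous_on {0..1} (arcs ! i)"
    using arc_facts(3) arcs_nth by simp
  have link: "\<forall>i<n. (arcs ! i) 1 = (arcs ! ((i + 1) mod n)) 0"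
    using arc_facts(5) arcs_nth arcs_start planar_n by simp
  have inj: "\<forall>i<n. inj_on (arcs ! i) {0..1}"
    using arc_facts(2) arcs_nth by simp
  have vertex: "(j = i \<and> s = 0) \<or> (j = (i + n - 1) mod n \<and> s = 1)"
    if ij: "i < n" "j < n" and s: "s \<in> {0..1}" and eq: "(arcs ! j) s = (arcs ! i) 0" for i j s
  proof -
    obtain f where f: "f 0 = 0"
      "\<And>t. t \<in> {0..1} \<Longrightarrow> snd (snd ((arcs ! i) t)) > 0"
      "\<And>t. t \<in> {0..1} \<Longrightarrow> (arcs ! i) t = snd (snd ((arcs ! i) t)) *\<^sub>R lift1 ((poly_edges ws ! i) (f t))"
      using arcs_points[OF ij(1)] by metis
    obtain g where g: "inj_on g {0..1}" "g 0 = 0" "g 1 = 1" "\<And>t. t \<in> {0..1} \<Longrightarrow> g t \<in> {0..1}"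
      "\<And>t. t \<in> {0..1} \<Longrightarrow> snd (snd ((arcs ! j) t)) > 0"
      "\<And>t. t \<in> {0..1} \<Longrightarrow> (arcs ! j) t = snd (snd ((arcs ! j) t)) *\<^sub>R lift1 ((poly_edges ws ! j) (g t))"
      using arcs_points[OF ij(2)] by metis
    have "(poly_edges ws ! j) (g s) = gnomonic ((arcs ! j) s)"
      using gnomonic_ray[OF g(6)[OF s] g(5)[OF s]] by simp
    also have "\<dots> = (poly_edges ws ! i) 0"
      unfolding eq using gnomonic_ray[OF f(3)[of 0] f(2)[of 0]] f(1) by simp
    finally have "(j = i \<and> g s = 0) \<or> (j = (i + n - 1) mod n \<and> g s = 1)"
      using planar_vertex[OF ij g(4)[OF s]] by blast
    moreover have "g s = 0 \<Longrightarrow> s = 0" "g s = 1 \<Longrightarrow> s = 1"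
      using inj_onD[OF g(1), of s 0] inj_onD[OF g(1), of s 1] g(2,3) s by auto
    ultimately show ?thesis
      by blast
  qed
  have card: "card {i. i < n \<and> x \<in> (arcs ! i) ` {0..1}} \<le> 2" for x
  proof -
    have "{i. i < n \<and> x \<in> (arcs ! i) ` {0..1}} \<subseteq> {i. i < n \<and> gnomonic x \<in> (poly_edges ws ! i) ` {0..1}}"
      using gnomonic_arc_image by blast
    then have "card {i. i < n \<and> x \<in> (arcs ! i) ` {0..1}} \<le> card {i. i < n \<and> gnomonic x \<in> (poly_edges ws ! i) ` {0..1}}"
      by (intro card_mono) auto
    then show ?thesis
      using planar_card[of "gnomonic x"] by linarith
  qed
  have tr: "cross3 (arc_normal (project_arcs ws ! i)) (arc_normal (project_arcs ws ! j)) \<noteq> 0"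
    if ij: "i < n" "j < n" "i \<noteq> j" and x: "x \<in> (arcs ! i) ` {0..1} \<inter> (arcs ! j) ` {0..1}"
      and V: "x \<notin> {(arcs ! i) 0 | i. i < n}" for i j x
  proof -
    \<comment> \<open>A point that is not an arc endpoint must not project to a vertex, since planar
      transversality is known only away from vertices.\<close>
    have "gnomonic x \<noteq> (poly_edges ws ! k) 0" if k: "k < n" for k
    proof
      assume "gnomonic x = (poly_edges ws ! k) 0"
      then have "gnomonic x = ws ! k"
        using k n by (simp add: linepath_def)
      then have "x = (arcs ! k) 0"
        using arc_upper(2)[OF ij(1)] x arcs_start[OF k] by (metis IntD1 inverse_eq_divide)
      then show False
        using V k by blast
    qed
    then have "cross2 (ws ! (Suc i mod n) - ws ! i) (ws ! (Suc j mod n) - ws ! j) \<noteq> 0"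
      using planar_tr[OF ij, of "gnomonic x"] gnomonic_arc_image ij x by blast
    then have "cross3 (cross3 (lift1 (ws ! i)) (lift1 (ws ! (Suc i mod n))))
        (cross3 (lift1 (ws ! j)) (lift1 (ws ! (Suc j mod n)))) \<noteq> 0"
      by (rule cross3_lift1_neq_0)
    moreover obtain k where "k \<noteq> 0"
      "arc_normal (project_arcs ws ! i) = k *\<^sub>R cross3 (lift1 (ws ! i)) (lift1 (ws ! (Suc i mod n)))"
      using arc_facts(6)[OF ij(1)] ij(1) n by auto
    moreover obtain l where "l \<noteq> 0"
      "arc_normal (project_arcs ws ! j) = l *\<^sub>R cross3 (lift1 (ws ! j)) (lift1 (ws ! (Suc j mod n)))"
      using arc_facts(6)[OF ij(2)] ij(2) n by auto
    ultimately show ?thesis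
      by (simp add: cross3_scale)
  qed
  show ?thesis
    unfolding spherical_stick_curve_def regular_edge_curve_def Let_def
      length_map project_arcs_simps(1) n[symmetric]
  proof (intro conjI allI impI ballI)
    show "1 \<le> n"
      using planar_n by simp
  qed (fact valid[rule_format] cont[rule_format] link[rule_format] inj[rule_format] vertex card tr)+
qed

text \<open>At a double point of the spherical curve the radius \<open>r\<close> is the height
  \<open>h\<close> divided by the same number for both strands, so over and under are
  preserved.\<close>

lemma spherical_represents_project:
  assumes "planar_represents ws K"
  shows "spherical_represents (project_arcs ws) K"
proof -
  obtain q where q: "simple_path q" "pathfinish q = pathstart q"
    "\<And>t. t \<in> {0..1} \<Longrightarrow> proj_xy (q t) = join_list (poly_edges ws) t" "ambient_isotopic (path_image q) K"
    using assms unfolding planar_represents_def by blast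
  let ?c = "join_list arcs"
  have cne: "arcs \<noteq> []" "length arcs = n"
    using planar_n n by (auto simp flip: length_greater_0_conv)
  have "path ?c \<and> pathstart ?c = (arcs ! 0) 0 \<and> pathfinish ?c = (arcs ! (length arcs - 1)) 1"
  proof (rule join_list_continuous)
    show "\<forall>i<length arcs. continuous_on {0..1} (arcs ! i)"
      using arc_facts(3) arcs_nth cne(2) by simp
    show "\<forall>i. Suc i < length arcs \<longrightarrow> (arcs ! i) 1 = (arcs ! Suc i) 0"
    proof (intro allI impI)
      fix i assume "Suc i < length arcs"
      then have i: "i < n" "Suc i < n" "Suc i mod n = Suc i"
        unfolding cne(2) by simp_all
      show "(arcs ! i) 1 = (arcs ! Suc i) 0"
        unfolding arcs_nth[OF i(1)] arcs_start[OF i(2)] i(3)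
        by (rule arc_facts(5)[OF i(1), unfolded i(3)])
    qed
  qed (use cne in simp)
  moreover have "(arcs ! (n - 1)) 1 = (arcs ! 0) 0"
    using arc_facts(5)[of "n - 1"] arcs_nth[of "n - 1"] arcs_start[of 0] planar_n by simp
  ultimately have c: "continuous_on {0..1} ?c" "?c 1 = ?c 0"
    using cne(2) by (auto simp: path_def pathstart_def pathfinish_def)
  have "list_all2 (\<lambda>e e'. \<exists>f. reparam (\<lambda>c p. snd (snd c) > 0 \<and> c = snd (snd c) *\<^sub>R lift1 p) e e' f)
      arcs (poly_edges ws)"
    using arcs_reparam cne(2) n by (intro list_all2_all_nthI) auto
  then obtain f where "reparam (\<lambda>c p. snd (snd c) > 0 \<and> c = snd (snd c) *\<^sub>R lift1 p) ?c
      (join_list (poly_edges ws)) f"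
    using reparam_join_list cne(1) by blast
  then have f: "continuous_on {0..1} f" "inj_on f {0..1}" "f ` {0..1} \<subseteq> {0..1}" "f 0 = 0" "f 1 = 1"
    and fc: "\<And>t. t \<in> {0..1} \<Longrightarrow> snd (snd (?c t)) > 0"
      "\<And>t. t \<in> {0..1} \<Longrightarrow> ?c t = snd (snd (?c t)) *\<^sub>R lift1 (join_list (poly_edges ws) (f t))"
    unfolding reparam_def by blast+
  have fI: "f t \<in> {0..1}" if "t \<in> {0..1}" for t
    using that f(3) by blast
  \<comment> \<open>By connectedness \<open>f\<close> covers the whole interval, so the new lift
    traces all of \<open>q\<close>.\<close>
  have f_image: "f ` {0..1} = {0..1}"
    using f(3) connected_contains_Icc[OF connected_continuous_image[OF f(1)], of 0 1] f(4,5)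
    by (metis atLeastAtMost_iff connected_Icc image_eqI order_refl subset_antisym zero_le_one)
  have qc: "continuous_on {0..1} q"
    using q(1) by (simp add: simple_path_def path_def)
  obtain b where "\<forall>x\<in>q ` {0..1}. norm x \<le> b"
    using compact_imp_bounded[OF compact_continuous_image[OF qc]] unfolding bounded_iff by auto
  then have b: "norm (q t) \<le> b" if "t \<in> {0..1}" for t
    using that by blast
  \<comment> \<open>As \<open>b\<close> bounds the norm along \<open>q\<close>, heights are at least
    \<open>- b\<close>, and the shift \<open>b + 1\<close> makes them at least 1.\<close>
  define h where "h t = snd (snd (q (f t))) + (b + 1)" for t
  have h: "h t \<ge> 1" if "t \<in> {0..1}" for t
  proof -
    obtain x y z where xyz: "q (f t) = (x, y, z)"
      by (metis prod_cases3)
    have "\<bar>z\<bar> \<le> norm (x, y, z)"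
      using order_trans[OF norm_snd_le[of z y] norm_snd_le[of "(y, z)" x]] by simp
    then have "\<bar>snd (snd (q (f t)))\<bar> \<le> norm (q (f t))"
      by (simp add: xyz)
    then show ?thesis
      using b[OF fI[OF that]] by (simp add: h_def)
  qed
  \<comment> \<open>Dividing by the height of the arc point places the lifted point at height
    exactly \<open>h t\<close>.\<close>
  define r where "r t = h t / snd (snd (?c t))" for t
  have r_pos: "r t > 0" if "t \<in> {0..1}" for t
    using h[OF that] fc(1)[OF that] by (simp add: r_def)
  have hc: "continuous_on {0..1} h"
    unfolding h_def by (intro continuous_intros continuous_on_compose2[OF qc f(1)]) (use f(3) in auto)
  have rc: "continuous_on {0..1} r"
    unfolding r_def using fc(1) by (intro continuous_intros hc c) force
  have q10: "q 1 = q 0"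
    using q(2) by (simp add: pathstart_def pathfinish_def)
  have lift: "r t *\<^sub>R ?c t = cone_map (b + 1) (q (f t))" if t: "t \<in> {0..1}" for t
  proof -
    have "r t *\<^sub>R ?c t = h t *\<^sub>R lift1 (proj_xy (q (f t)))"
      using fc(1)[OF t] fc(2)[OF t] q(3)[OF fI[OF t]] unfolding r_def
      by (metis (no_types, lifting) scaleR_scaleR nonzero_eq_divide_eq less_irrefl)
    then show ?thesis
      by (simp add: h_def cone_map_def lift1_def proj_xy_def case_prod_unfold)
  qed
  have cone_inj: "q (f s) = q (f t)"
    if "s \<in> {0..1}" "t \<in> {0..1}" "cone_map (b + 1) (q (f s)) = cone_map (b + 1) (q (f t))" for s t
    using that h[of s] h[of t] by (auto simp: cone_map_def h_def case_prod_unfold prod_eq_iff)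
  have "simple_path (\<lambda>t. r t *\<^sub>R ?c t)"
    unfolding simple_path_def loop_free_def
  proof (intro conjI ballI impI)
    show "path (\<lambda>t. r t *\<^sub>R ?c t)"
      unfolding path_def by (intro continuous_intros rc c)
    fix s t :: real
    assume st: "s \<in> {0..1}" "t \<in> {0..1}" "r s *\<^sub>R ?c s = r t *\<^sub>R ?c t"
    then have "q (f s) = q (f t)"
      using cone_inj lift by metis
    then have "f s = f t \<or> f s = 0 \<and> f t = 1 \<or> f s = 1 \<and> f t = 0"
      using q(1) fI st unfolding simple_path_def loop_free_def by blast
    then show "s = t \<or> s = 0 \<and> t = 1 \<or> s = 1 \<and> t = 0"
      using inj_onD[OF f(2), of s t] inj_onD[OF f(2), of s 0] inj_onD[OF f(2), of s 1]
        inj_onD[OF f(2), of t 0] inj_onD[OF f(2), of t 1] f(4,5) st by auto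
  qed
  moreover have "path_image (\<lambda>t. r t *\<^sub>R ?c t) = cone_map (b + 1) ` path_image q"
  proof -
    have "path_image (\<lambda>t. r t *\<^sub>R ?c t) = (\<lambda>t. cone_map (b + 1) (q (f t))) ` {0..1}"
      unfolding path_image_def by (intro image_cong lift refl)
    also have "\<dots> = cone_map (b + 1) ` q ` f ` {0..1}"
      by (simp only: image_image)
    finally show ?thesis
      by (simp add: f_image path_image_def)
  qed
  moreover have "ambient_isotopic (path_image q) (cone_map (b + 1) ` path_image q)"
  proof (rule ambient_isotopic_cone_map)
    fix x y z assume "(x, y, z) \<in> path_image q"
    then have "(x, y, z) \<in> q ` f ` {0..1}"
      by (simp only: path_image_def f_image)
    then obtain t where "t \<in> {0..1}" "q (f t) = (x, y, z)"
      by auto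
    then show "1 \<le> z + (b + 1)"
      using h[of t] by (simp add: h_def)
  qed
  then have "ambient_isotopic (cone_map (b + 1) ` path_image q) K"
    using ambient_isotopic_trans[OF ambient_isotopic_sym q(4)] by blast
  moreover have "r 0 = r 1"
    by (simp add: r_def h_def f c q10)
  ultimately show ?thesis
    unfolding spherical_represents_def using rc r_pos by (intro exI[of _ r]) auto
qed

end

section \<open>Generic projections of polygons\<close>

lemma cross3_add_left: "cross3 (u + v) w = cross3 u w + cross3 v w"
  and cross3_scale_left: "cross3 (c *\<^sub>R u) w = c *\<^sub>R cross3 u w"
  and cross3_scale_right: "cross3 u (c *\<^sub>R w) = c *\<^sub>R cross3 u w"
  and cross3_self: "cross3 u u = 0"
  and cross3_inner_left: "cross3 u w \<bullet> u = 0"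
  by (cases u; cases v; cases w; simp add: cross3_def algebra_simps zero_prod_def)+

text \<open>Two planes containing \<open>d\<close> meet along \<open>d\<close>; the factor is the
  determinant of \<open>u\<close>, \<open>v\<close>, \<open>d\<close>. In
  \<open>no_triple_point\<close> it recovers the projection direction from two edges met by one
  projection line.\<close>

lemma cross3_cross3_common:
  "cross3 (cross3 d u) (cross3 d v) = (cross3 u v \<bullet> d) *\<^sub>R d"
  by (cases d; cases u; cases v; simp add: cross3_def algebra_simps)

lemma cross3_eq_0_parallel:
  assumes "cross3 u v = 0" "v \<noteq> 0"
  obtains c where "u = c *\<^sub>R v"
proof -
  obtain u1 u2 u3 v1 v2 v3 where uv: "u = (u1, u2, u3)" "v = (v1, v2, v3)"
    by (metis prod_cases3)
  have eqs: "u2 * v3 = u3 * v2" "u3 * v1 = u1 * v3" "u1 * v2 = u2 * v1"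
    using assms(1) by (auto simp: uv cross3_def zero_prod_def)
  consider "v1 \<noteq> 0" | "v2 \<noteq> 0" | "v3 \<noteq> 0"
    using assms(2) by (auto simp: uv zero_prod_def)
  then show thesis
  proof cases
    case 1
    then show ?thesis
      using eqs by (intro that[of "u1 / v1"]) (auto simp: uv field_simps)
  next
    case 2
    then show ?thesis
      using eqs by (intro that[of "u2 / v2"]) (auto simp: uv field_simps)
  next
    case 3
    then show ?thesis
      using eqs by (intro that[of "u3 / v3"]) (auto simp: uv field_simps)
  qed
qed

text \<open>The condition is affine in \<open>(a, b)\<close>: it cuts out a line, or nothing when
  \<open>N\<close> is vertical.\<close>

lemma negligible_direction_plane:
  assumes "N \<noteq> (0 :: pt3)"
  shows "negligible {(a, b). N \<bullet> (a, b, 1) = 0}"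
proof -
  obtain x y z where N: "N = (x, y, z)"
    by (metis prod_cases3)
  have "{(a, b). N \<bullet> (a, b, 1) = 0} = {p. (x, y) \<bullet> p = - z}"
    by (auto simp: N inner_prod_def)
  moreover have "(x, y) \<noteq> 0 \<or> - z \<noteq> 0"
    using assms by (auto simp: N zero_prod_def)
  ultimately show ?thesis
    using negligible_hyperplane by metis
qed

text \<open>The first two coordinates of the cross product give affine equations in
  \<open>(a, b)\<close>, at least one of which is nontrivial.\<close>

lemma negligible_direction_point:
  assumes "u \<noteq> (0 :: pt3)"
  shows "negligible {(a, b). cross3 (a, b, 1) u = 0}"
proof -
  obtain x y z where u: "u = (x, y, z)"
    by (metis prod_cases3)
  have "{(a, b). cross3 (a, b, 1) u = 0} \<subseteq> {(a, b). (0, z, - y) \<bullet> (a, b, 1) = 0}"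
    and "{(a, b). cross3 (a, b, 1) u = 0} \<subseteq> {(a, b). (- z, 0, x) \<bullet> (a, b, 1) = 0}"
    by (auto simp: u cross3_def zero_prod_def inner_prod_def algebra_simps)
  moreover have "(0, z, - y) \<noteq> (0 :: pt3) \<or> (- z, 0, x) \<noteq> (0 :: pt3)"
    using assms by (auto simp: u zero_prod_def)
  ultimately show ?thesis
    using negligible_direction_plane negligible_subset by meson
qed

lemma differentiable_Pair:
  assumes "f differentiable (at x within S)" "g differentiable (at x within S)"
  shows "(\<lambda>s. (f s, g s)) differentiable (at x within S)"
proof -
  obtain D where D: "(f has_derivative D) (at x within S)"
    using assms(1) unfolding differentiable_def by blast
  obtain E where E: "(g has_derivative E) (at x within S)"
    using assms(2) unfolding differentiable_def by blast
  show ?thesis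
    by (rule differentiableI[OF has_derivative_Pair[OF D E]])
qed

text \<open>Rescaling \<open>f s\<close> to height 1 gives a differentiable map from a subset of the
  line into the plane, whose image has measure zero. The restriction to nonzero height makes the
  division legitimate.\<close>

lemma negligible_direction_curve:
  fixes f :: "real \<Rightarrow> pt3"
  assumes "f differentiable_on UNIV"
  shows "negligible {(a, b). \<exists>s. snd (snd (f s)) \<noteq> 0 \<and> f s = snd (snd (f s)) *\<^sub>R (a, b, 1)}"
proof (rule negligible_subset)
  let ?S = "{s. snd (snd (f s)) \<noteq> 0}"
  let ?g = "\<lambda>s. (fst (f s) / snd (snd (f s)), fst (snd (f s)) / snd (snd (f s)))"
  have f: "f differentiable (at s within ?S)" for s
    using assms differentiable_within_subset unfolding differentiable_on_def by blast
  have comps: "(\<lambda>s. fst (f s)) differentiable (at s within ?S)"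
    "(\<lambda>s. fst (snd (f s))) differentiable (at s within ?S)"
    "(\<lambda>s. snd (snd (f s))) differentiable (at s within ?S)" for s
  proof -
    obtain D where D: "(f has_derivative D) (at s within ?S)"
      using f[of s] unfolding differentiable_def by blast
    show "(\<lambda>s. fst (f s)) differentiable (at s within ?S)"
      "(\<lambda>s. fst (snd (f s))) differentiable (at s within ?S)"
      "(\<lambda>s. snd (snd (f s))) differentiable (at s within ?S)"
      using has_derivative_fst[OF D] has_derivative_fst[OF has_derivative_snd[OF D]]
        has_derivative_snd[OF has_derivative_snd[OF D]]
      unfolding differentiable_def by blast+
  qed
  have "(\<lambda>s. fst (f s) / snd (snd (f s))) differentiable (at s within ?S)"
       "(\<lambda>s. fst (snd (f s)) / snd (snd (f s))) differentiable (at s within ?S)" if "s \<in> ?S" for s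
    using that comps by (auto intro!: differentiable_divide)
  then have "?g differentiable (at s within ?S)" if "s \<in> ?S" for s
    using that by (intro differentiable_Pair)
  then have "?g differentiable_on ?S"
    unfolding differentiable_on_def by blast
  then show "negligible (?g ` ?S)"
    by (intro negligible_differentiable_image_lowdim) simp_all
  show "{(a, b). \<exists>s. snd (snd (f s)) \<noteq> 0 \<and> f s = snd (snd (f s)) *\<^sub>R (a, b, 1)} \<subseteq> ?g ` ?S"
  proof clarify
    fix a b s assume s: "snd (snd (f s)) \<noteq> 0" "f s = snd (snd (f s)) *\<^sub>R (a, b, 1)"
    obtain x y z where f: "f s = (x, y, z)"
      by (metis prod_cases3)
    have "(a, b) = ?g s"
      using s by (simp add: f)
    then show "(a, b) \<in> ?g ` ?S"
      using s(1) by blast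
  qed
qed

lemma generic_direction:
  fixes U P :: "pt3 set" and C :: "(real \<Rightarrow> pt3) set"
  assumes "finite U" "finite P" "finite C" "0 \<notin> U" "0 \<notin> P"
    and "\<And>f. f \<in> C \<Longrightarrow> f differentiable_on UNIV"
  obtains a b :: real where "\<And>u. u \<in> U \<Longrightarrow> cross3 (a, b, 1) u \<noteq> 0" "\<And>N. N \<in> P \<Longrightarrow> N \<bullet> (a, b, 1) \<noteq> 0"
    "\<And>f s. f \<in> C \<Longrightarrow> snd (snd (f s)) \<noteq> 0 \<Longrightarrow> f s \<noteq> snd (snd (f s)) *\<^sub>R (a, b, 1)"
proof -
  let ?U = "\<lambda>u. {(a, b). cross3 (a, b, 1) u = 0}"
  let ?P = "\<lambda>N. {(a, b). N \<bullet> (a, b, 1) = (0 :: real)}"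
  let ?C = "\<lambda>f. {(a, b). \<exists>s :: real. snd (snd (f s)) \<noteq> 0 \<and> f s = snd (snd (f s)) *\<^sub>R (a, b, 1)}"
  have "negligible (\<Union> (?U ` U))"
    using assms by (intro negligible_Union) (auto intro: negligible_direction_point)
  moreover have "negligible (\<Union> (?P ` P))"
  proof (intro negligible_Union finite_imageI assms(2))
    fix T assume "T \<in> ?P ` P"
    then obtain N :: pt3 where "N \<in> P" "T = ?P N"
      by blast
    then show "negligible T"
      using negligible_direction_plane[of N] assms(5) by metis
  qed
  moreover have "negligible (\<Union> (?C ` C))"
  proof (intro negligible_Union finite_imageI assms(3))
    fix T assume "T \<in> ?C ` C"
    then obtain f where "f \<in> C" "T = ?C f"
      by blast
    then show "negligible T"
      using negligible_direction_curve[of f] assms(6) by metis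
  qed
  ultimately have neg: "negligible (\<Union> (?U ` U) \<union> \<Union> (?P ` P) \<union> \<Union> (?C ` C))"
    by (intro negligible_Un)
  have "\<exists>p. p \<notin> B" if "negligible B" for B :: "pt2 set"
    using that non_negligible_UNIV by (metis UNIV_eq_I)
  from this[OF neg] obtain p where "p \<notin> \<Union> (?U ` U) \<union> \<Union> (?P ` P) \<union> \<Union> (?C ` C)"
    by (rule exE)
  then have p: "p \<notin> \<Union> (?U ` U)" "p \<notin> \<Union> (?P ` P)" "p \<notin> \<Union> (?C ` C)"
    by (simp_all only: Un_iff de_Morgan_disj not_False_eq_True)
  obtain a b where ab: "p = (a, b)"
    by (cases p)
  show thesis
  proof (rule that)
    show "cross3 (a, b, 1) u \<noteq> 0" if "u \<in> U" for u
      using p(1) that unfolding ab by blast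
    show "N \<bullet> (a, b, 1) \<noteq> 0" if "N \<in> P" for N
      using p(2) that unfolding ab by blast
    show "f s \<noteq> snd (snd (f s)) *\<^sub>R (a, b, 1)" if "f \<in> C" "snd (snd (f s)) \<noteq> 0" for f s
      using p(3) that unfolding ab by blast
  qed
qed

text \<open>The direction of the line through \<open>p + s *\<^sub>R u\<close> that meets the lines \<open>q + \<real> v\<close> and \<open>r + \<real> w\<close>:
  it lies in the two planes spanned by this point and one of the lines.\<close>
definition transversal_dir :: "pt3 \<Rightarrow> pt3 \<Rightarrow> pt3 \<Rightarrow> pt3 \<Rightarrow> pt3 \<Rightarrow> pt3 \<Rightarrow> real \<Rightarrow> pt3" where
  "transversal_dir p u q v r w s = cross3 (cross3 (p + s *\<^sub>R u - q) v) (cross3 (p + s *\<^sub>R u - r) w)"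

lemma differentiable_on_transversal_dir: "transversal_dir p u q v r w differentiable_on UNIV"
proof -
  obtain p1 p2 p3 u1 u2 u3 where 1: "p = (p1, p2, p3)" "u = (u1, u2, u3)"
    by (metis prod_cases3)
  obtain q1 q2 q3 v1 v2 v3 where 2: "q = (q1, q2, q3)" "v = (v1, v2, v3)"
    by (metis prod_cases3)
  obtain r1 r2 r3 w1 w2 w3 where 3: "r = (r1, r2, r3)" "w = (w1, w2, w3)"
    by (metis prod_cases3)
  show ?thesis
    unfolding differentiable_on_def transversal_dir_def[abs_def] 1 2 3
    by (simp add: cross3_def differentiable_Pair)
qed

section \<open>Oblique projection of a polygonal knot\<close>

lemma inj_on_linepath:
  assumes "a \<noteq> b"
  shows "inj_on (linepath a b) S"
proof (rule inj_onI)
  fix s t assume "linepath a b s = linepath a b t"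
  then have "(s - t) *\<^sub>R (b - a) = 0"
    by (simp add: linepath_def algebra_simps)
  then show "s = t"
    using assms by simp
qed

definition par_proj :: "real \<Rightarrow> real \<Rightarrow> pt3 \<Rightarrow> pt2" where
  "par_proj a b p = proj_xy (shear a b p)"

lemma linear_par_proj: "linear (par_proj a b)"
  by (rule linearI) (auto simp: par_proj_def proj_xy_def shear_def case_prod_unfold algebra_simps)

lemma par_proj_eq_iff: "par_proj a b p = par_proj a b q \<longleftrightarrow> (\<exists>c. p - q = c *\<^sub>R (a, b, 1))"
  by (cases p; cases q) (auto simp: par_proj_def proj_xy_def shear_def algebra_simps
       intro!: exI[of _ "snd (snd p) - snd (snd q)"])

text \<open>Both sides are the determinant of \<open>u\<close>, \<open>v\<close> and the projection
  direction.\<close>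

lemma cross2_par_proj: "cross2 (par_proj a b u) (par_proj a b v) = cross3 u v \<bullet> (a, b, 1)"
  by (cases u; cases v)
     (simp add: par_proj_def proj_xy_def shear_def cross2_def cross3_def inner_prod_def algebra_simps)

lemma linepath_linear_image:
  assumes "linear f"
  shows "linepath (f a) (f b) = f \<circ> linepath a b"
  using assms by (auto simp: linepath_def linear_add linear_scale)

lemma poly_edges_map_linear:
  assumes "linear f"
  shows "poly_edges (map f vs) = map (\<lambda>e. f \<circ> e) (poly_edges vs)"
  unfolding poly_edges_def map_map length_map
proof (rule map_cong[OF refl])
  fix i assume "i \<in> set [0..<length vs]"
  then have "i < length vs" "(i + 1) mod length vs < length vs"
    by (auto intro: mod_less_divisor)
  then show "linepath (map f vs ! i) (map f vs ! ((i + 1) mod length vs)) =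
      ((\<lambda>e. f \<circ> e) \<circ> (\<lambda>i. linepath (vs ! i) (vs ! ((i + 1) mod length vs)))) i"
    by (simp add: linepath_linear_image[OF assms])
qed

context
  fixes vs :: "pt3 list" and n :: nat
  assumes knot: "polygonal_knot vs" and n: "n = length vs"
begin

definition "vertex i = vs ! i"
definition "dir i = vs ! (Suc i mod n) - vs ! i"
definition "edge i s = vertex i + s *\<^sub>R dir i"

lemma n_pos: "n > 0"
  using knot n by (auto simp: polygonal_knot_def)

lemma edge_eq: "i < n \<Longrightarrow> poly_edges vs ! i = edge i"
  using n[symmetric] by (simp add: fun_eq_iff edge_def vertex_def dir_def linepath_def algebra_simps)

lemma edges_meet:
  assumes "i < n" "j < n" "s \<in> {0..1}" "t \<in> {0..1}" "edge i s = edge j t"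
  shows "i = j \<and> s = t \<or> j = Suc i mod n \<and> s = 1 \<and> t = 0 \<or> i = Suc j mod n \<and> t = 1 \<and> s = 0"
proof -
  have "simple_path (join_list (poly_edges vs))"
    using knot by (simp add: polygonal_knot_def)
  moreover have "\<forall>i. Suc i < length (poly_edges vs) \<longrightarrow> (poly_edges vs ! i) 1 = (poly_edges vs ! Suc i) 0"
    by (auto simp: linepath_def)
  ultimately show ?thesis
    using simple_closed_join_list[of "poly_edges vs" i j s t] assms edge_eq n by simp
qed

text \<open>A degenerate edge would take the same value at 0 and at the interior parameter 1/2.
  Comparing 0 with 1 would fail for a single edge, whose ends may coincide.\<close>

lemma dir_neq_0: "i < n \<Longrightarrow> dir i \<noteq> 0"
  using edges_meet[of i i 0 "1/2"] by (auto simp: edge_def)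

lemma planar_represents_pr:
  "planar_represents (map (par_proj a b) vs) (shear a b ` path_image (join_list (poly_edges vs)))"
proof -
  let ?c = "join_list (poly_edges vs)"
  have vs: "vs \<noteq> []" "poly_edges vs \<noteq> []"
    using n_pos n by (auto simp: poly_edges_def)
  have c: "simple_path ?c" "pathfinish ?c = pathstart ?c"
    using knot by (auto simp: polygonal_knot_def)
  have "continuous_on UNIV (shear a b)"
    by (auto simp: shear_def case_prod_unfold intro!: continuous_intros)
  moreover have "inj (shear a b)"
    by (auto simp: shear_def inj_on_def)
  ultimately have "simple_path (shear a b \<circ> ?c)"
    using c(1) unfolding simple_path_def loop_free_def
    by (auto simp: inj_eq intro: path_continuous_image continuous_on_subset)
  moreover have "pathfinish (shear a b \<circ> ?c) = pathstart (shear a b \<circ> ?c)"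
    using c(2) by (simp add: pathfinish_def pathstart_def)
  moreover have "proj_xy ((shear a b \<circ> ?c) t) = join_list (poly_edges (map (par_proj a b) vs)) t" for t
    unfolding poly_edges_map_linear[OF linear_par_proj] join_list_map[OF vs(2)]
    by (simp add: par_proj_def)
  \<comment> \<open>Reflexivity, obtained from the shear with both parameters 0.\<close>
  moreover have "ambient_isotopic (path_image (shear a b \<circ> ?c)) (shear a b ` path_image ?c)"
    using ambient_isotopic_shear[of _ 0 0] by (simp add: path_image_compose shear_def case_prod_unfold)
  ultimately show ?thesis
    unfolding planar_represents_def by blast
qed

text \<open>Generic directions: no edge projects to a point; a vertex off the line of an edge stays
  off the projected line; nonparallel edges have nonparallel images; the direction is none of those
  computed by \<open>transversal_dir\<close>.\<close>

context
  fixes a b :: real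
  assumes gen_dir: "\<And>i. i < n \<Longrightarrow> cross3 (a, b, 1) (dir i) \<noteq> 0"
    and gen_vertex: "\<And>i j. \<lbrakk>i < n; j < n; cross3 (vertex i - vertex j) (dir j) \<noteq> 0\<rbrakk>
      \<Longrightarrow> cross3 (vertex i - vertex j) (dir j) \<bullet> (a, b, 1) \<noteq> 0"
    and gen_dirs: "\<And>i j. \<lbrakk>i < n; j < n; cross3 (dir i) (dir j) \<noteq> 0\<rbrakk>
      \<Longrightarrow> cross3 (dir i) (dir j) \<bullet> (a, b, 1) \<noteq> 0"
    and gen_triple: "\<And>i j k s. \<lbrakk>i < n; j < n; k < n;
        snd (snd (transversal_dir (vertex i) (dir i) (vertex j) (dir j) (vertex k) (dir k) s)) \<noteq> 0\<rbrakk>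
      \<Longrightarrow> transversal_dir (vertex i) (dir i) (vertex j) (dir j) (vertex k) (dir k) s \<noteq>
        snd (snd (transversal_dir (vertex i) (dir i) (vertex j) (dir j) (vertex k) (dir k) s)) *\<^sub>R (a, b, 1)"
begin

abbreviation "d \<equiv> (a, b, 1 :: real)"
abbreviation "pr \<equiv> par_proj a b"

text \<open>If \<open>c\<close> were nonzero, the plane through vertex \<open>i\<close> and the line
  of edge \<open>j\<close> would contain the projection direction, which \<open>gen_vertex\<close>
  forbids.\<close>

lemma not_parallel_offset:
  assumes "i < n" "j < n" "vertex i - vertex j = c *\<^sub>R d + t *\<^sub>R dir j"
  shows "c = 0"
proof (rule ccontr)
  assume c: "c \<noteq> 0"
  have N: "cross3 (vertex i - vertex j) (dir j) = c *\<^sub>R cross3 d (dir j)"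
    unfolding assms(3) cross3_add_left cross3_scale_left cross3_self by simp
  then have "cross3 (vertex i - vertex j) (dir j) \<noteq> 0"
    using c gen_dir[OF assms(2)] by simp
  moreover have "cross3 (vertex i - vertex j) (dir j) \<bullet> d = 0"
    unfolding N inner_scaleR_left cross3_inner_left by simp
  ultimately show False
    using gen_vertex[OF assms(1,2)] by blast
qed

lemma pr_vertex_edge:
  assumes "i < n" "j < n" "pr (edge j s) = pr (vertex i)"
  shows "edge j s = vertex i"
proof -
  obtain c where c: "vertex i - edge j s = c *\<^sub>R d"
    using assms(3) par_proj_eq_iff[of a b "vertex i" "edge j s"] by metis
  then have "vertex i - vertex j = c *\<^sub>R d + s *\<^sub>R dir j"
    unfolding edge_def by (simp only: diff_diff_add[symmetric] diff_eq_eq)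
  then have "c = 0"
    using not_parallel_offset assms by blast
  with c show ?thesis
    by (simp flip: zero_prod_def)
qed

text \<open>Nonparallel edges are settled by \<open>gen_dirs\<close>. For parallel edges whose
  images meet, the offset of the vertices combines \<open>d\<close> with the common direction, and
  \<open>not_parallel_offset\<close> forces the two points in space to agree.\<close>

lemma pr_crossing_transverse:
  assumes "i < n" "j < n" "pr (edge i s) = pr (edge j t)" "edge i s \<noteq> edge j t"
  shows "cross3 (dir i) (dir j) \<bullet> d \<noteq> 0"
proof
  assume "cross3 (dir i) (dir j) \<bullet> d = 0"
  then have "cross3 (dir i) (dir j) = 0"
    using gen_dirs assms(1,2) by blast
  then obtain l where l: "dir i = l *\<^sub>R dir j"
    using cross3_eq_0_parallel dir_neq_0[OF assms(2)] by blast
  obtain c where c: "edge i s - edge j t = c *\<^sub>R d"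
    using assms(3) par_proj_eq_iff by metis
  have "vertex i - vertex j = (edge i s - edge j t) + t *\<^sub>R dir j - s *\<^sub>R dir i"
    by (simp add: edge_def)
  also have "\<dots> = c *\<^sub>R d + (t - s * l) *\<^sub>R dir j"
    unfolding c l by (simp only: scaleR_left_diff_distrib scaleR_scaleR add_diff_eq)
  finally have "c = 0"
    using not_parallel_offset assms(1,2) by blast
  with c assms(4) show False
    by (simp flip: zero_prod_def)
qed

text \<open>The projection line through the three points is a common transversal, so
  \<open>transversal_dir\<close> is a multiple of \<open>d\<close>. The factor is nonzero because
  the points are distinct and edges \<open>j\<close> and \<open>k\<close> cross
  transversally.\<close>

lemma no_triple_point:
  assumes ijk: "i < n" "j < n" "k < n"
    and eq: "pr (edge i s) = pr (edge j t)" "pr (edge i s) = pr (edge k t')"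
    and neq: "edge i s \<noteq> edge j t" "edge i s \<noteq> edge k t'" "edge j t \<noteq> edge k t'"
  shows False
proof -
  let ?F = "transversal_dir (vertex i) (dir i) (vertex j) (dir j) (vertex k) (dir k) s"
  obtain c where c: "edge i s - edge j t = c *\<^sub>R d"
    using eq(1) par_proj_eq_iff by metis
  obtain c' where c': "edge i s - edge k t' = c' *\<^sub>R d"
    using eq(2) par_proj_eq_iff by metis
  have c0: "c \<noteq> 0" "c' \<noteq> 0"
    using c c' neq by (auto simp flip: zero_prod_def)
  have D: "cross3 (dir j) (dir k) \<bullet> d \<noteq> 0"
    using pr_crossing_transverse[of j k t t'] ijk eq neq by metis
  have "vertex i + s *\<^sub>R dir i - vertex j = c *\<^sub>R d + t *\<^sub>R dir j"
    using c by (simp add: edge_def algebra_simps)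
  moreover have "vertex i + s *\<^sub>R dir i - vertex k = c' *\<^sub>R d + t' *\<^sub>R dir k"
    using c' by (simp add: edge_def algebra_simps)
  ultimately have "?F = cross3 (c *\<^sub>R cross3 d (dir j)) (c' *\<^sub>R cross3 d (dir k))"
    unfolding transversal_dir_def by (simp only: cross3_add_left cross3_scale_left cross3_self scaleR_zero_right add_0_right)
  also have "\<dots> = (c * c' * (cross3 (dir j) (dir k) \<bullet> d)) *\<^sub>R d"
    by (simp only: cross3_scale_left cross3_scale_right cross3_cross3_common scaleR_scaleR mult.assoc mult.left_commute)
  finally have F: "?F = (c * c' * (cross3 (dir j) (dir k) \<bullet> d)) *\<^sub>R d" .
  then have z: "snd (snd ?F) = c * c' * (cross3 (dir j) (dir k) \<bullet> d)"
    by simp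
  have "snd (snd ?F) \<noteq> 0"
    unfolding z using c0 D by simp
  then show False
    using gen_triple[OF ijk] F z by metis
qed

lemma pr_edge_nth:
  assumes "i < n"
  shows "(poly_edges (map pr vs) ! i) s = pr (edge i s)"
  unfolding poly_edges_map_linear[OF linear_par_proj] using assms n edge_eq[of i]
  by simp

lemma pr_edge_0: "pr (edge i 0) = pr (vertex i)"
  by (simp add: edge_def)

text \<open>Distinct edges of the knot share only vertices, so away from projected vertices a double
  point comes from two different points in space.\<close>

lemma edges_neq:
  assumes "i < n" "j < n" "i \<noteq> j" "s \<in> {0..1}" "t \<in> {0..1}" "\<And>k. k < n \<Longrightarrow> pr (edge i s) \<noteq> pr (vertex k)"
  shows "edge i s \<noteq> edge j t"
proof
  assume eq: "edge i s = edge j t"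
  then have "s = 0 \<or> t = 0"
    using edges_meet assms by blast
  then have "edge i s = vertex i \<or> edge i s = vertex j"
    using eq by (auto simp: edge_def)
  then show False
    using assms(1,2,6) by metis
qed

lemma planar_stick_curve_pr: "planar_stick_curve (map pr vs)"
proof -
  let ?es = "poly_edges (map pr vs)"
  have len: "length vs = n"
    using n by simp
  have image: "x \<in> (?es ! i) ` {0..1} \<longleftrightarrow> (\<exists>s\<in>{0..1}. x = pr (edge i s))" if "i < n" for x i
    using pr_edge_nth[OF that] by (auto simp: image_iff)
  have cont: "continuous_on {0..1} (?es ! i)" if "i < n" for i
    using that n by auto
  have link: "(?es ! i) 1 = (?es ! ((i + 1) mod n)) 0" if "i < n" for i
    using that n n_pos by (simp add: linepath_def)
  have inj: "inj_on (?es ! i) {0..1}" if i: "i < n" for i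
  proof -
    have "pr (vertex i) \<noteq> pr (vs ! (Suc i mod n))"
    proof
      assume "pr (vertex i) = pr (vs ! (Suc i mod n))"
      then obtain c where "dir i = c *\<^sub>R d"
        unfolding dir_def vertex_def using par_proj_eq_iff by metis
      then have "cross3 d (dir i) = 0"
        by (simp only: cross3_scale_right cross3_self scaleR_zero_right)
      with gen_dir[OF i] show False
        by contradiction
    qed
    then show ?thesis
      using i n n_pos by (simp add: vertex_def inj_on_linepath)
  qed
  have vert: "(j = i \<and> s = 0) \<or> (j = (i + n - 1) mod n \<and> s = 1)"
    if ij: "i < n" "j < n" and s: "s \<in> {0..1}" and eq: "(?es ! j) s = (?es ! i) 0" for i j s
  proof -
    have "edge j s = edge i 0"
      using pr_vertex_edge[OF ij, of s] eq pr_edge_nth ij pr_edge_0 by (simp add: edge_def)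
    then have "j = i \<and> s = 0 \<or> i = Suc j mod n \<and> s = 1"
      using edges_meet[OF ij(2,1) s, of 0] by auto
    \<comment> \<open>\<open>edges_meet\<close> speaks of the cyclic successor, regularity of the
      predecessor.\<close>
    moreover have "j = (i + n - 1) mod n" if "i = Suc j mod n"
    proof (cases "Suc j = n")
      case True
      then show ?thesis
        using that by auto
    next
      case False
      then show ?thesis
        using that ij by simp
    qed
    ultimately show ?thesis
      by blast
  qed
  have neq: "edge i s \<noteq> edge j t"
    if "i < n" "j < n" "i \<noteq> j" "s \<in> {0..1}" "t \<in> {0..1}" "\<forall>k<n. x \<noteq> pr (vertex k)" "x = pr (edge i s)"
    for i j s t x
    using edges_neq[OF that(1-5)] that(6,7) by blast
  \<comment> \<open>Over a vertex only the two edges ending there can pass; elsewhere a third edge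
    would give a triple point.\<close>
  have card: "card {i. i < n \<and> x \<in> (?es ! i) ` {0..1}} \<le> 2" (is "card ?T \<le> 2") for x
  proof (cases "\<exists>k<n. x = pr (vertex k)")
    case True
    then obtain k where k: "k < n" "x = (?es ! k) 0"
      using pr_edge_nth pr_edge_0 by metis
    have "?T \<subseteq> {k, (k + n - 1) mod n}"
    proof
      fix i assume "i \<in> ?T"
      then obtain s where s: "i < n" "s \<in> {0..1}" "(?es ! i) s = (?es ! k) 0"
        using k(2) by auto
      then show "i \<in> {k, (k + n - 1) mod n}"
        using vert[OF k(1) s] by blast
    qed
    then have "card ?T \<le> card {k, (k + n - 1) mod n}"
      by (intro card_mono) auto
    also have "\<dots> \<le> 2"
      by (simp add: card_insert_if)
    finally show ?thesis .
  next
    case False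
    show ?thesis
    proof (rule ccontr)
      assume "\<not> card ?T \<le> 2"
      then obtain T where T: "T \<subseteq> ?T" "card T = 3"
        using obtain_subset_with_card_n[of 3 ?T] by auto
      then obtain i j k where ijk: "T = {i, j, k}" "i \<noteq> j" "i \<noteq> k" "j \<noteq> k"
        using card_3_iff[of T] by auto
      then have lt: "i < n" "j < n" "k < n"
        using T by auto
      obtain s t t' where "s \<in> {0..1}" "t \<in> {0..1}" "t' \<in> {0..1}"
        "x = pr (edge i s)" "x = pr (edge j t)" "x = pr (edge k t')"
        using T(1) image lt unfolding ijk(1) by (metis (no_types, lifting) insert_subset mem_Collect_eq)
      then show False
        using no_triple_point[of i j k s t t'] neq[of i j s t x] neq[of i k s t' x] neq[of j k t t' x]
          ijk lt False by metis
    qed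
  qed
  have tr: "cross2 (map pr vs ! ((i + 1) mod n) - map pr vs ! i) (map pr vs ! ((j + 1) mod n) - map pr vs ! j) \<noteq> 0"
    if ij: "i < n" "j < n" "i \<noteq> j" and x: "x \<in> (?es ! i) ` {0..1} \<inter> (?es ! j) ` {0..1}"
      and V: "x \<notin> {(?es ! i) 0 | i. i < n}" for i j x
  proof -
    have V: "\<forall>k<n. x \<noteq> pr (vertex k)"
      using V pr_edge_nth pr_edge_0 by (metis (mono_tags, lifting) mem_Collect_eq)
    obtain s t where st: "s \<in> {0..1}" "t \<in> {0..1}" "x = pr (edge i s)" "x = pr (edge j t)"
      using x image ij by auto
    then have "cross3 (dir i) (dir j) \<bullet> d \<noteq> 0"
      using pr_crossing_transverse[of i j s t] neq[OF ij st(1,2) V st(3)] ij by simp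
    moreover have "map pr vs ! ((i + 1) mod n) - map pr vs ! i = pr (dir i)" if "i < n" for i
      using that len n_pos by (simp add: dir_def linear_diff[OF linear_par_proj])
    ultimately show ?thesis
      using ij by (simp only: cross2_par_proj not_False_eq_True)
  qed
  show ?thesis
    unfolding planar_stick_curve_def regular_edge_curve_def Let_def poly_edges_simps(1) length_map len
  proof (intro conjI allI impI ballI)
    show "1 \<le> n"
      using n_pos by simp
  qed (fact cont link inj vert card tr)+
qed

end

lemma polygonal_knot_generic_projection:
  obtains a b where "planar_stick_curve (map (par_proj a b) vs)"
    "planar_represents (map (par_proj a b) vs) (shear a b ` path_image (join_list (poly_edges vs)))"
proof -
  let ?I = "{..<n}"
  \<comment> \<open>Zero normals, which arise from vertices on the line of an edge and from parallel
    edges, impose no condition and are filtered out so that every remaining one defines a null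
    set.\<close>
  let ?P = "{N \<in> (\<lambda>(i, j). cross3 (vertex i - vertex j) (dir j)) ` (?I \<times> ?I). N \<noteq> 0} \<union>
    {N \<in> (\<lambda>(i, j). cross3 (dir i) (dir j)) ` (?I \<times> ?I). N \<noteq> 0}"
  let ?C = "(\<lambda>(i, j, k). transversal_dir (vertex i) (dir i) (vertex j) (dir j) (vertex k) (dir k)) ` (?I \<times> ?I \<times> ?I)"
  have "finite (dir ` ?I)" "finite ?P" "finite ?C" "0 \<notin> dir ` ?I" "0 \<notin> ?P"
    using dir_neq_0 by auto
  moreover have "f differentiable_on UNIV" if "f \<in> ?C" for f
    using that by (force intro: differentiable_on_transversal_dir)
  ultimately obtain a b :: real where ab: "\<And>u. u \<in> dir ` ?I \<Longrightarrow> cross3 (a, b, 1) u \<noteq> 0"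
    "\<And>N. N \<in> ?P \<Longrightarrow> N \<bullet> (a, b, 1) \<noteq> 0"
    "\<And>f s. f \<in> ?C \<Longrightarrow> snd (snd (f s)) \<noteq> 0 \<Longrightarrow> f s \<noteq> snd (snd (f s)) *\<^sub>R (a, b, 1)"
    using generic_direction[of "dir ` ?I" ?P ?C] by blast
  have 1: "cross3 (a, b, 1) (dir i) \<noteq> 0" if "i < n" for i
    using ab(1) that by blast
  have 2: "cross3 (vertex i - vertex j) (dir j) \<bullet> (a, b, 1) \<noteq> 0"
    if "i < n" "j < n" "cross3 (vertex i - vertex j) (dir j) \<noteq> 0" for i j
    by (rule ab(2)) (use that in \<open>auto intro!: image_eqI[of _ _ "(i, j)"]\<close>)
  have 3: "cross3 (dir i) (dir j) \<bullet> (a, b, 1) \<noteq> 0"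
    if "i < n" "j < n" "cross3 (dir i) (dir j) \<noteq> 0" for i j
    by (rule ab(2)) (use that in \<open>auto intro!: image_eqI[of _ _ "(i, j)"]\<close>)
  have 4: "transversal_dir (vertex i) (dir i) (vertex j) (dir j) (vertex k) (dir k) s \<noteq>
        snd (snd (transversal_dir (vertex i) (dir i) (vertex j) (dir j) (vertex k) (dir k) s)) *\<^sub>R (a, b, 1)"
    if "i < n" "j < n" "k < n"
        "snd (snd (transversal_dir (vertex i) (dir i) (vertex j) (dir j) (vertex k) (dir k) s)) \<noteq> 0" for i j k s
    by (rule ab(3)) (use that in \<open>auto intro!: image_eqI[of _ _ "(i, j, k)"]\<close>)
  show thesis
  proof (rule that)
    show "planar_stick_curve (map (par_proj a b) vs)"
      by (rule planar_stick_curve_pr[OF 1 2 3 4])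
  qed (rule planar_represents_pr)
qed

end

section \<open>Planar and spherical stick numbers\<close>

lemma tame_planar_diagram:
  assumes "tame K"
  shows "\<exists>ws. planar_stick_curve ws \<and> planar_represents ws K"
proof -
  obtain vs where vs: "polygonal_knot vs" "ambient_isotopic (path_image (join_list (poly_edges vs))) K"
    using assms unfolding tame_def by blast
  obtain a b where ab: "planar_stick_curve (map (par_proj a b) vs)"
    "planar_represents (map (par_proj a b) vs) (shear a b ` path_image (join_list (poly_edges vs)))"
    using polygonal_knot_generic_projection[OF vs(1) refl] .
  have "ambient_isotopic (shear a b ` path_image (join_list (poly_edges vs))) K"
    using ambient_isotopic_trans[OF ambient_isotopic_sym[OF ambient_isotopic_shear] vs(2)] .
  then have "planar_represents (map (par_proj a b) vs) K"
    using ab(2) ambient_isotopic_trans unfolding planar_represents_def by blast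
  with ab(1) show ?thesis
    by blast
qed

theorem theorem3p2:
  fixes K :: "pt3 set"
  assumes "is_knot K" and "tame K" and "\<not> is_unknot K"
  shows "sps K \<le> pl K"
proof -
  have "\<exists>n ws. length ws = n \<and> planar_stick_curve ws \<and> planar_represents ws K"
    using tame_planar_diagram[OF assms(2)] by blast
  then obtain ws where ws: "length ws = pl K" "planar_stick_curve ws" "planar_represents ws K"
    unfolding pl_def by (rule LeastI_ex[THEN exE]) blast
  have "spherical_stick_curve (project_arcs ws)" "spherical_represents (project_arcs ws) K"
    using spherical_stick_curve_project[OF ws(2) refl] spherical_represents_project[OF ws(2) refl ws(3)]
    by blast+
  then show ?thesis
    unfolding sps_def using ws(1) by (intro Least_le exI[of _ "project_arcs ws"]) simp
qed

end
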